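(* Let $\mu$ be a positive Borel measure on $\mathbb R$ supported on at least two distinct points with $\int_{\mathbb R}(1+|t|)^{-1}d\mu(t)<\infty$, let $\alpha\in\mathbb R\setminus\{0\}$, and let $\nu$ be a positive Borel measure on $\mathbb R$. For compactly supported $C^1$ functions $f$ define $$Vf(s)=f(s)-\alpha\int_{\mathbb R}\frac{f(s)-f(t)}{s-t}\,d\mu(t)$$ (integrand at $t=s$ interpreted as $f'(s)$). Assume $V$ extends to a bounded operator $V:L^2(\mu)\to L^2(\nu)$ with $\operatorname{Ker}V=\{0\}$. Then there exists a measurable function $h$ with $1/h\in L^\infty(\nu)$ such that $M_hV:L^2(\mu)\to L^2(\nu)$ is unitary (equivalently, $V:L^2(\mu)\to L^2(|h|^2d\nu)$ is unitary). Moreover $U:=M_hV$ satisfies $UA_\alpha=M_sU$ (in the resolvent sense $U(A_\alpha-\lambda I)^{-1}=(M_s-\lambda I)^{-1}U$, $\lambda\notin\mathbb R$), where $M_s$ is multiplication by the independent variable in $L^2(\nu)$.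
   Context: $M_t$ denotes multiplication by the independent variable on $L^2(\mu)$. $A_\alpha$ denotes the rank one perturbation "$M_t+\alpha(\,\cdot\,,\mathbf 1)\mathbf 1$" of $M_t$ on $L^2(\mu)$, defined as the self-adjoint operator whose resolvent is, for $\lambda\in\mathbb C\setminus\mathbb R$, $(A_\alpha-\lambda I)^{-1}f=(M_t-\lambda I)^{-1}f-\frac{\alpha\int\frac{f(t)d\mu(t)}{t-\lambda}}{1+\alpha F(\lambda)}(M_t-\lambda I)^{-1}\mathbf 1$, with $F(\lambda)=\int\frac{d\mu(t)}{t-\lambda}$. *)

theory Defs
  imports "HOL-Analysis.Analysis"
begin

definition measure_support :: "real measure \<Rightarrow> real set" where
  "measure_support M = {x. \<forall>U. open U \<longrightarrow> x \<in> U \<longrightarrow> emeasure M U > 0}"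

definition L2 :: "real measure \<Rightarrow> (real \<Rightarrow> complex) \<Rightarrow> bool" where
  "L2 M f \<longleftrightarrow> f \<in> borel_measurable M \<and> integrable M (\<lambda>x. (cmod (f x))^2)"

definition L2norm :: "real measure \<Rightarrow> (real \<Rightarrow> complex) \<Rightarrow> real" where
  "L2norm M f = sqrt (\<integral>x. (cmod (f x))^2 \<partial>M)"

definition C1c :: "(real \<Rightarrow> complex) \<Rightarrow> bool" where
  "C1c f \<longleftrightarrow> f C1_differentiable_on UNIV \<and> compact (closure {t. f t \<noteq> 0})"

definition dq :: "(real \<Rightarrow> complex) \<Rightarrow> real \<Rightarrow> real \<Rightarrow> complex" where
  "dq f s t = (if t = s then vector_derivative f (at s) else (f s - f t) / complex_of_real (s - t))"

definition Vop :: "real \<Rightarrow> real measure \<Rightarrow> (real \<Rightarrow> complex) \<Rightarrow> real \<Rightarrow> complex" where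
  "Vop \<alpha> \<mu> f s = f s - complex_of_real \<alpha> * (\<integral>t. dq f s t \<partial>\<mu>)"

definition Fcauchy :: "real measure \<Rightarrow> complex \<Rightarrow> complex" where
  "Fcauchy \<mu> z = (\<integral>t. 1 / (complex_of_real t - z) \<partial>\<mu>)"

text \<open>Resolvent (A_alpha - z I)^{-1} of the rank one perturbation A_alpha of M_t on L2(mu).\<close>
definition resolv_A :: "real \<Rightarrow> real measure \<Rightarrow> complex \<Rightarrow> (real \<Rightarrow> complex) \<Rightarrow> real \<Rightarrow> complex" where
  "resolv_A \<alpha> \<mu> z f t =
     f t / (complex_of_real t - z)
     - (complex_of_real \<alpha> * (\<integral>u. f u / (complex_of_real u - z) \<partial>\<mu>))
       / (1 + complex_of_real \<alpha> * Fcauchy \<mu> z) * (1 / (complex_of_real t - z))"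

end

theory Submission
  imports Defs
begin

text \<open>Formally \<open>V (M\<^sub>t + \<alpha> (\<cdot>, 1) 1) = M\<^sub>s V\<close> with \<open>V 1 = 1\<close>. Approximating the Cauchy kernel
  \<open>1 / (t - z)\<close> by cut-offs makes this rigorous: \<open>T (1 / (t - z)) = (1 + \<alpha> F(z)) / (s - z)\<close>. Since a
  function is determined by its Cauchy transform, it follows that \<open>T\<close> intertwines the resolvent of
  \<open>A\<^sub>\<alpha>\<close> with multiplication by \<open>1 / (s - z)\<close>. Hence \<open>T T*\<close> commutes with these multiplications and is
  itself multiplication by a function \<open>\<psi>\<close>, with \<open>0 \<le> \<psi> \<le> \<parallel>T\<parallel>\<^sup>2\<close>, and \<open>\<psi> \<noteq> 0\<close>
  almost everywhere because the kernels \<open>1 / (s - z)\<close> lie in the range of \<open>T\<close>. Put \<open>h = \<psi>\<^sup>-\<^sup>1\<^sup>/\<^sup>2\<close> and \<open>U = h T\<close>; then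
  \<open>U U* = 1\<close>, and \<open>U\<close> is unitary since \<open>Ker T = 0\<close>.\<close>

section \<open>Complex L2 spaces\<close>

text \<open>The constant 1 need not lie in L2(\<mu>); the kernels \<open>1 / (t - z)\<close>, which
  are the resolvent of M_t applied to 1, stand in for it. Nor is \<nu> known to be sigma-finite in
  advance. Both gaps close through the factor \<open>1 + \<alpha> F(z)\<close>: it is non-zero
  because \<alpha> is real and Im F(z) is a positive multiple of Im z, so a kernel on the \<nu> side
  is an image under T and belongs to L2(\<nu>), and its nowhere vanishing square yields
  sigma-finiteness. Density of the kernels is not proved as such. An identity known on kernels is
  transposed to the adjoint, where it becomes an equality of two L2 functions with the same Cauchy
  transform, and is then carried back by duality. This is why the Riesz theorem and adjoints are
  developed before anything else. The weight h may be unbounded, so U* cannot be obtained by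
  composing T* with h. Instead U is shown to be a contraction by truncating 1/\<psi>; as it
  intertwines the same resolvents as T, U U* is again a multiplication, and a single vector
  determines its multiplier.\<close>

lemma borel_measurable_cnj [measurable]:
  "f \<in> borel_measurable M \<Longrightarrow> (\<lambda>x. cnj (f x)) \<in> borel_measurable M"
  by (rule borel_measurable_continuous_on) (auto intro: continuous_intros)

lemma L2_bound:
  assumes "L2 M f" "g \<in> borel_measurable M" "AE x in M. cmod (g x) \<le> C * cmod (f x)"
  shows "L2 M g"
  unfolding L2_def
proof (intro conjI)
  have f: "integrable M (\<lambda>x. C\<^sup>2 * (cmod (f x))\<^sup>2)"
    using assms(1) unfolding L2_def by auto
  show "integrable M (\<lambda>x. (cmod (g x))\<^sup>2)"
  proof (rule Bochner_Integration.integrable_bound[OF f])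
    show "AE x in M. norm ((cmod (g x))\<^sup>2) \<le> norm (C\<^sup>2 * (cmod (f x))\<^sup>2)"
      using assms(3)
    proof eventually_elim
      case (elim x)
      have "(cmod (g x))\<^sup>2 \<le> (C * cmod (f x))\<^sup>2"
        using elim by (intro power_mono) auto
      then show ?case by (simp add: power_mult_distrib)
    qed
  qed (use assms(2) in measurable)
qed (use assms in auto)

lemma L2_measurable [measurable_dest]: "L2 M f \<Longrightarrow> f \<in> borel_measurable M"
  unfolding L2_def by auto

lemma L2_integrable: "L2 M f \<Longrightarrow> integrable M (\<lambda>x. (cmod (f x))\<^sup>2)"
  unfolding L2_def by auto

lemma L2_mult:
  assumes "L2 M f" "m \<in> borel_measurable M" "AE x in M. cmod (m x) \<le> C"
  shows "L2 M (\<lambda>x. m x * f x)"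
proof (rule L2_bound[OF assms(1)])
  show "AE x in M. cmod (m x * f x) \<le> C * cmod (f x)"
    using assms(3) by eventually_elim (simp add: norm_mult mult_right_mono)
qed (use assms L2_measurable in measurable)

lemma L2_scale: "L2 M f \<Longrightarrow> L2 M (\<lambda>x. c * f x)"
  by (rule L2_mult[where C = "cmod c"]) auto

lemma L2_uminus: "L2 M f \<Longrightarrow> L2 M (\<lambda>x. - f x)"
  using L2_scale[of M f "-1"] by simp

lemma L2_cnj: "L2 M f \<Longrightarrow> L2 M (\<lambda>x. cnj (f x))"
  by (rule L2_bound[where C = 1]) (auto dest: L2_measurable)

lemma L2_cmod: "L2 M f \<Longrightarrow> L2 M (\<lambda>x. complex_of_real (cmod (f x)))"
  by (rule L2_bound[where C = 1]) (auto dest: L2_measurable)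

lemma L2_cong_AE:
  assumes "L2 M f" "g \<in> borel_measurable M" "AE x in M. f x = g x"
  shows "L2 M g"
  by (rule L2_bound[where C = 1, OF assms(1,2)]) (use assms(3) in auto)

lemma L2_prod_integrable:
  assumes "L2 M f" "L2 M g"
  shows "integrable M (\<lambda>x. f x * g x)"
proof (rule Bochner_Integration.integrable_bound)
  show "integrable M (\<lambda>x. (cmod (f x))\<^sup>2 + (cmod (g x))\<^sup>2)"
    using assms by (intro Bochner_Integration.integrable_add L2_integrable)
  show "AE x in M. norm (f x * g x) \<le> norm ((cmod (f x))\<^sup>2 + (cmod (g x))\<^sup>2)"
  proof (rule AE_I2)
    fix x
    have "2 * (cmod (f x) * cmod (g x)) \<le> (cmod (f x))\<^sup>2 + (cmod (g x))\<^sup>2"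
      using sum_squares_bound[of "cmod (f x)" "cmod (g x)"] by (simp add: mult.assoc)
    moreover have "0 \<le> cmod (f x) * cmod (g x)" by simp
    ultimately have "cmod (f x) * cmod (g x) \<le> (cmod (f x))\<^sup>2 + (cmod (g x))\<^sup>2" by linarith
    then show "norm (f x * g x) \<le> norm ((cmod (f x))\<^sup>2 + (cmod (g x))\<^sup>2)"
      by (simp add: norm_mult)
  qed
qed (use assms L2_measurable in measurable)

lemma L2_add:
  assumes "L2 M f" "L2 M g"
  shows "L2 M (\<lambda>x. f x + g x)"
  unfolding L2_def
proof (intro conjI)
  show "integrable M (\<lambda>x. (cmod (f x + g x))\<^sup>2)"
  proof (rule Bochner_Integration.integrable_bound)
    show "integrable M (\<lambda>x. 2 * (cmod (f x))\<^sup>2 + 2 * (cmod (g x))\<^sup>2)"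
      using assms by (intro Bochner_Integration.integrable_add integrable_mult_right L2_integrable)
    show "AE x in M. norm ((cmod (f x + g x))\<^sup>2) \<le> norm (2 * (cmod (f x))\<^sup>2 + 2 * (cmod (g x))\<^sup>2)"
    proof (rule AE_I2)
      fix x
      have "(cmod (f x + g x))\<^sup>2 \<le> (cmod (f x) + cmod (g x))\<^sup>2"
        by (intro power_mono norm_triangle_ineq) auto
      also have "\<dots> \<le> 2 * (cmod (f x))\<^sup>2 + 2 * (cmod (g x))\<^sup>2"
        using sum_squares_bound[of "cmod (f x)" "cmod (g x)"] by (simp add: power2_sum)
      finally show "norm ((cmod (f x + g x))\<^sup>2) \<le> norm (2 * (cmod (f x))\<^sup>2 + 2 * (cmod (g x))\<^sup>2)"
        by simp
    qed
  qed (use assms L2_measurable in measurable)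
qed (use assms L2_measurable in measurable)

lemma L2_diff: "L2 M f \<Longrightarrow> L2 M g \<Longrightarrow> L2 M (\<lambda>x. f x - g x)"
  using L2_add[of M f "\<lambda>x. - g x"] by (simp add: L2_uminus)

lemma L2norm_nonneg [simp]: "0 \<le> L2norm M f"
  unfolding L2norm_def by simp

lemma L2norm_power2: "(L2norm M f)\<^sup>2 = (\<integral>x. (cmod (f x))\<^sup>2 \<partial>M)"
  unfolding L2norm_def by (simp add: real_sqrt_pow2)

lemma L2norm_cong_AE:
  assumes "f \<in> borel_measurable M" "g \<in> borel_measurable M" "AE x in M. f x = g x"
  shows "L2norm M f = L2norm M g"
proof -
  have "(\<integral>x. (cmod (f x))\<^sup>2 \<partial>M) = (\<integral>x. (cmod (g x))\<^sup>2 \<partial>M)"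
    using assms(3) by (intro integral_cong_AE) (use assms in auto)
  then show ?thesis by (simp add: L2norm_def)
qed

lemma L2norm_eq_0:
  assumes "L2 M f" "L2norm M f = 0"
  shows "AE x in M. f x = 0"
proof -
  have "(\<integral>x. (cmod (f x))\<^sup>2 \<partial>M) = 0"
    using assms(2) by (simp flip: L2norm_power2)
  then have "AE x in M. (cmod (f x))\<^sup>2 = 0"
    using L2_integrable[OF assms(1)] by (subst (asm) integral_nonneg_eq_0_iff_AE) auto
  then show ?thesis by auto
qed

definition ip :: "real measure \<Rightarrow> (real \<Rightarrow> complex) \<Rightarrow> (real \<Rightarrow> complex) \<Rightarrow> complex" where
  "ip M f g = (\<integral>x. f x * cnj (g x) \<partial>M)"

lemma ip_integrable: "L2 M f \<Longrightarrow> L2 M g \<Longrightarrow> integrable M (\<lambda>x. f x * cnj (g x))"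
  by (intro L2_prod_integrable L2_cnj)

lemma ip_add_left:
  "L2 M f \<Longrightarrow> L2 M g \<Longrightarrow> L2 M k \<Longrightarrow> ip M (\<lambda>x. f x + g x) k = ip M f k + ip M g k"
  unfolding ip_def by (simp add: distrib_right ip_integrable)

lemma ip_scale_left: "ip M (\<lambda>x. c * f x) k = c * ip M f k"
  unfolding ip_def by (simp add: mult.assoc)

lemma ip_cnj: "cnj (ip M f g) = ip M g f"
  unfolding ip_def by (simp flip: Bochner_Integration.integral_cnj add: mult.commute)

lemma ip_diff_right:
  "L2 M f \<Longrightarrow> L2 M g \<Longrightarrow> L2 M k \<Longrightarrow> ip M k (\<lambda>x. f x - g x) = ip M k f - ip M k g"
  unfolding ip_def by (simp add: right_diff_distrib ip_integrable)

lemma ip_self: "ip M f f = complex_of_real ((L2norm M f)\<^sup>2)"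
  unfolding ip_def L2norm_power2 integral_complex_of_real[symmetric] complex_norm_square ..

lemma ip_cong_AE:
  assumes "f \<in> borel_measurable M" "f' \<in> borel_measurable M" "g \<in> borel_measurable M" "g' \<in> borel_measurable M"
    "AE x in M. f x = f' x" "AE x in M. g x = g' x"
  shows "ip M f g = ip M f' g'"
  unfolding ip_def using assms(5,6) by (intro integral_cong_AE) (use assms(1-4) in auto)

text \<open>Used with the projection coefficient for Cauchy-Schwarz, with \<open>c = 1\<close> and
  \<open>c = -1\<close> for the parallelogram identity, and with a small \<open>c\<close> for the
  variation in the Riesz theorem.\<close>

lemma L2norm_expand:
  assumes f: "L2 M f" and g: "L2 M g"
  shows "(L2norm M (\<lambda>x. f x + c * g x))\<^sup>2
    = (L2norm M f)\<^sup>2 + 2 * Re (cnj c * ip M f g) + (cmod c)\<^sup>2 * (L2norm M g)\<^sup>2"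
proof -
  have pt: "(cmod (f x + c * g x))\<^sup>2
      = (cmod (f x))\<^sup>2 + 2 * Re (cnj c * (f x * cnj (g x))) + (cmod c)\<^sup>2 * (cmod (g x))\<^sup>2" for x
    by (simp add: cmod_power2) (simp add: algebra_simps power2_eq_square)
  have i: "integrable M (\<lambda>x. cnj c * (f x * cnj (g x)))"
    using ip_integrable[OF f g] by simp
  have "(\<integral>x. Re (cnj c * (f x * cnj (g x))) \<partial>M) = Re (cnj c * ip M f g)"
    unfolding ip_def using integral_Re[OF i] by simp
  then show ?thesis
    unfolding L2norm_power2 pt
    using integrable_Re[OF i] L2_integrable[OF f] L2_integrable[OF g]
    by (simp only: Bochner_Integration.integral_add Bochner_Integration.integrable_add
        integrable_mult_right Bochner_Integration.integral_mult_right_zero)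
qed

lemma L2_Cauchy_Schwarz:
  assumes f: "L2 M f" and g: "L2 M g"
  shows "cmod (ip M f g) \<le> L2norm M f * L2norm M g"
proof (cases "L2norm M g = 0")
  case True
  have "ip M f g = ip M f (\<lambda>x. 0)"
    by (rule ip_cong_AE) (use assms L2norm_eq_0[OF g True] in \<open>auto dest: L2_measurable\<close>)
  then show ?thesis by (simp add: ip_def True)
next
  case False
  define A B c where "A = (L2norm M f)\<^sup>2" and "B = (L2norm M g)\<^sup>2" and "c = ip M f g"
  have B: "B > 0" using False by (simp add: B_def)
  \<comment> \<open>The coefficient \<open>- c / B\<close> removes from \<open>f\<close> its
    component along \<open>g\<close>, which makes the nonnegative expansion as small as
    possible.\<close>
  have "0 \<le> (L2norm M (\<lambda>x. f x + (- c / of_real B) * g x))\<^sup>2" by simp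
  also have "\<dots> = A + 2 * Re (cnj (- c / of_real B) * c) + (cmod (- c / of_real B))\<^sup>2 * B"
    unfolding A_def B_def c_def by (rule L2norm_expand[OF f g])
  also have "cnj (- c / of_real B) * c = of_real (- (cmod c)\<^sup>2 / B)"
    using complex_norm_square[of c] by (simp add: mult.commute)
  also have "(cmod (- c / of_real B))\<^sup>2 * B = (cmod c)\<^sup>2 / B"
    using B by (simp add: norm_divide power_divide power2_eq_square)
  finally have "(cmod c)\<^sup>2 / B \<le> A" by simp
  then have "(cmod c)\<^sup>2 \<le> A * B" using B by (simp add: divide_le_eq)
  then have "(cmod c)\<^sup>2 \<le> (L2norm M f * L2norm M g)\<^sup>2"
    by (simp add: A_def B_def power_mult_distrib)
  then show ?thesis unfolding c_def by (rule power2_le_imp_le) simp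
qed

lemma L2_L1_bound:
  assumes f: "L2 M f" and g: "L2 M g"
  shows "(\<integral>x. cmod (f x * g x) \<partial>M) \<le> L2norm M f * L2norm M g"
proof -
  have "ip M (\<lambda>x. complex_of_real (cmod (f x))) (\<lambda>x. complex_of_real (cmod (g x)))
      = complex_of_real (\<integral>x. cmod (f x * g x) \<partial>M)"
    unfolding ip_def by (simp add: norm_mult flip: integral_complex_of_real)
  moreover have "cmod (ip M (\<lambda>x. complex_of_real (cmod (f x))) (\<lambda>x. complex_of_real (cmod (g x))))
      \<le> L2norm M f * L2norm M g"
    using L2_Cauchy_Schwarz[OF L2_cmod[OF f] L2_cmod[OF g]] by (simp add: L2norm_def)
  ultimately show ?thesis by simp
qed

section \<open>Completeness and the Riesz representation theorem\<close>

lemma L2_tendsto_AE_subseq: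
  assumes "\<And>n. L2 M (f n)" "L2 M g" "(\<lambda>n. L2norm M (\<lambda>x. f n x - g x)) \<longlonglongrightarrow> 0"
  obtains r :: "nat \<Rightarrow> nat" where "strict_mono r" "AE x in M. (\<lambda>n. f (r n) x) \<longlonglongrightarrow> g x"
proof -
  have "(\<lambda>n. (L2norm M (\<lambda>x. f n x - g x))\<^sup>2) \<longlonglongrightarrow> 0\<^sup>2"
    by (intro tendsto_power assms(3))
  then have "(\<lambda>n. \<integral>x. norm ((cmod (f n x - g x))\<^sup>2) \<partial>M) \<longlonglongrightarrow> 0"
    by (simp add: L2norm_power2)
  then obtain r where r: "strict_mono (r::nat\<Rightarrow>nat)" "AE x in M. (\<lambda>n. (cmod (f (r n) x - g x))\<^sup>2) \<longlonglongrightarrow> 0"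
    using tendsto_L1_AE_subseq[of M "\<lambda>n x. (cmod (f n x - g x))\<^sup>2"] L2_integrable[OF L2_diff[OF assms(1,2)]]
    by auto
  from r(2) have "AE x in M. (\<lambda>n. f (r n) x) \<longlonglongrightarrow> g x"
  proof eventually_elim
    case (elim x)
    then have "(\<lambda>n. sqrt ((cmod (f (r n) x - g x))\<^sup>2)) \<longlonglongrightarrow> sqrt 0"
      by (intro tendsto_real_sqrt)
    then show ?case by (simp add: tendsto_norm_zero_iff LIM_zero_iff)
  qed
  with r(1) that show thesis by blast
qed

text \<open>Multiplication by the nowhere vanishing weight turns an L2-Cauchy sequence into an L1-Cauchy one,
  to which the library's almost everywhere convergent subsequence lemma applies.\<close>
lemma L2_complete:
  assumes w: "L2 M w" "\<And>x. w x \<noteq> 0" and f: "\<And>n. L2 M (f n)"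
    and Cauchy: "\<And>e. e > 0 \<Longrightarrow> \<exists>N. \<forall>m\<ge>N. \<forall>n\<ge>N. L2norm M (\<lambda>x. f m x - f n x) < e"
  obtains g where "L2 M g" "(\<lambda>n. L2norm M (\<lambda>x. f n x - g x)) \<longlonglongrightarrow> 0"
proof -
  note [measurable] = L2_measurable[OF f] L2_measurable[OF w(1)]
  obtain r :: "nat \<Rightarrow> nat" where r: "strict_mono r" "AE x in M. Cauchy (\<lambda>i. f (r i) x * w x)"
  proof (rule cauchy_L1_AE_cauchy_subseq[of M "\<lambda>n x. f n x * w x"])
    show "integrable M (\<lambda>x. f n x * w x)" for n by (intro L2_prod_integrable f w)
    fix e :: real assume e: "e > 0"
    \<comment> \<open>Adding 1 keeps \<open>K\<close> positive even for a null measure.\<close>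
    define K where "K = L2norm M w + 1"
    have K: "K > 0" by (simp add: K_def add_nonneg_pos)
    obtain N where N: "\<And>m n. m \<ge> N \<Longrightarrow> n \<ge> N \<Longrightarrow> L2norm M (\<lambda>x. f m x - f n x) < e / K"
      using Cauchy[of "e / K"] e K by auto
    have "(LINT x|M. norm (f i x * w x - f j x * w x)) < e" if "i \<ge> N" "j \<ge> N" for i j
    proof -
      have "(LINT x|M. norm (f i x * w x - f j x * w x)) \<le> L2norm M (\<lambda>x. f i x - f j x) * L2norm M w"
        using L2_L1_bound[OF L2_diff[OF f f] w(1), of i j] by (simp add: left_diff_distrib)
      also have "\<dots> \<le> L2norm M (\<lambda>x. f i x - f j x) * K"
        by (intro mult_left_mono) (auto simp: K_def)
      also have "\<dots> < e / K * K" using N[OF that] K by (intro mult_strict_right_mono)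
      finally show ?thesis using K by simp
    qed
    then show "\<exists>N. \<forall>i\<ge>N. \<forall>j\<ge>N. (LINT x|M. norm (f i x * w x - f j x * w x)) < e" by blast
  qed
  define g where "g x = lim (\<lambda>i. f (r i) x)" for x
  have gm [measurable]: "g \<in> borel_measurable M" unfolding g_def by measurable
  have lim: "AE x in M. (\<lambda>i. f (r i) x) \<longlonglongrightarrow> g x"
    using r(2)
  proof eventually_elim
    case (elim x)
    then have "convergent (\<lambda>i. f (r i) x * w x)" by (simp add: Cauchy_convergent)
    from convergent_mult[OF this convergent_const]
    have "convergent (\<lambda>i. f (r i) x * w x * inverse (w x))" .
    moreover have "f (r i) x * w x * inverse (w x) = f (r i) x" for i using w(2)[of x] by simp
    ultimately have "convergent (\<lambda>i. f (r i) x)" by (simp only:)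
    then show ?case by (simp add: g_def convergent_LIMSEQ_iff)
  qed
  have key: "\<exists>N. \<forall>n\<ge>N. L2 M (\<lambda>x. f n x - g x) \<and> L2norm M (\<lambda>x. f n x - g x) \<le> e" if e: "e > 0" for e
  proof -
    obtain N where N: "\<And>m n. m \<ge> N \<Longrightarrow> n \<ge> N \<Longrightarrow> L2norm M (\<lambda>x. f m x - f n x) < e"
      using Cauchy[OF e] by auto
    \<comment> \<open>Fatou is applied along the subsequence with \<open>n\<close> fixed, so the
      bound holds for every late \<open>f n\<close> and not only for the subsequence; finiteness of
      the integral also puts \<open>f n - g\<close> into L2.\<close>
    have "L2 M (\<lambda>x. f n x - g x) \<and> L2norm M (\<lambda>x. f n x - g x) \<le> e" if n: "n \<ge> N" for n
    proof -
      have "(\<integral>\<^sup>+x. ennreal ((cmod (f n x - g x))\<^sup>2) \<partial>M)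
          = (\<integral>\<^sup>+x. liminf (\<lambda>i. ennreal ((cmod (f n x - f (r i) x))\<^sup>2)) \<partial>M)"
      proof (rule nn_integral_cong_AE, use lim in eventually_elim)
        case (elim x)
        then have "(\<lambda>i. ennreal ((cmod (f n x - f (r i) x))\<^sup>2)) \<longlonglongrightarrow> ennreal ((cmod (f n x - g x))\<^sup>2)"
          by (intro tendsto_ennrealI tendsto_power tendsto_norm tendsto_diff tendsto_const)
        then show ?case by (intro lim_imp_Liminf[symmetric]) auto
      qed
      also have "\<dots> \<le> liminf (\<lambda>i. \<integral>\<^sup>+x. ennreal ((cmod (f n x - f (r i) x))\<^sup>2) \<partial>M)"
        by (rule nn_integral_liminf) simp
      also have "\<dots> \<le> ennreal (e\<^sup>2)"
      proof (rule Liminf_le)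
        have "\<forall>\<^sub>F i in sequentially. N \<le> r i"
          using filterlim_subseq[OF r(1)] by (simp add: filterlim_at_top)
        then show "\<forall>\<^sub>F i in sequentially. (\<integral>\<^sup>+x. ennreal ((cmod (f n x - f (r i) x))\<^sup>2) \<partial>M) \<le> ennreal (e\<^sup>2)"
        proof eventually_elim
          case (elim i)
          have "(\<integral>\<^sup>+x. ennreal ((cmod (f n x - f (r i) x))\<^sup>2) \<partial>M) = ennreal ((L2norm M (\<lambda>x. f n x - f (r i) x))\<^sup>2)"
            unfolding L2norm_power2 by (rule nn_integral_eq_integral) (auto intro!: L2_integrable L2_diff f)
          also have "\<dots> \<le> ennreal (e\<^sup>2)"
            using N[OF n elim] by (intro ennreal_leI power_mono) auto
          finally show ?case .
        qed
      qed simp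
      finally have *: "(\<integral>\<^sup>+x. ennreal ((cmod (f n x - g x))\<^sup>2) \<partial>M) \<le> ennreal (e\<^sup>2)" .
      then have int: "integrable M (\<lambda>x. (cmod (f n x - g x))\<^sup>2)"
        by (intro integrableI_bounded) (auto simp: less_top top_unique intro: le_less_trans)
      have "ennreal ((L2norm M (\<lambda>x. f n x - g x))\<^sup>2) \<le> ennreal (e\<^sup>2)"
        using * nn_integral_eq_integral[OF int] by (simp add: L2norm_power2)
      then have "(L2norm M (\<lambda>x. f n x - g x))\<^sup>2 \<le> e\<^sup>2" by simp
      then have "L2norm M (\<lambda>x. f n x - g x) \<le> e" by (rule power2_le_imp_le) (use e in simp)
      with int show ?thesis by (simp add: L2_def)
    qed
    then show ?thesis by blast
  qed
  obtain N where "L2 M (\<lambda>x. f N x - g x)" using key[of 1] by auto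
  from L2_diff[OF f[of N] this] have g: "L2 M g" by simp
  have "(\<lambda>n. L2norm M (\<lambda>x. f n x - g x)) \<longlonglongrightarrow> 0"
  proof (rule LIMSEQ_I)
    fix e :: real assume "e > 0"
    then obtain N where N: "\<And>n. n\<ge>N \<Longrightarrow> L2norm M (\<lambda>x. f n x - g x) \<le> e / 2" using key[of "e/2"] by auto
    show "\<exists>no. \<forall>n\<ge>no. norm (L2norm M (\<lambda>x. f n x - g x) - 0) < e"
      by (intro exI[of _ N]) (use N \<open>e > 0\<close> in force)
  qed
  with g that show thesis by blast
qed

lemma L2norm_scale: "L2norm M (\<lambda>x. c * f x) = cmod c * L2norm M f"
  unfolding L2norm_def by (simp add: norm_mult power_mult_distrib real_sqrt_mult)

text \<open>The representing element minimises \<open>\<parallel>f\<parallel>\<^sup>2 - 2 Re (l f)\<close>.\<close>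
lemma L2_Riesz:
  fixes l :: "(real \<Rightarrow> complex) \<Rightarrow> complex"
  assumes w: "L2 M w" "\<And>x. w x \<noteq> 0"
    and add: "\<And>f g. L2 M f \<Longrightarrow> L2 M g \<Longrightarrow> l (\<lambda>x. f x + g x) = l f + l g"
    and scale: "\<And>c f. L2 M f \<Longrightarrow> l (\<lambda>x. c * f x) = c * l f"
    and bdd: "\<And>f. L2 M f \<Longrightarrow> cmod (l f) \<le> C * L2norm M f"
  obtains k where "L2 M k" "\<And>f. L2 M f \<Longrightarrow> l f = ip M f k"
proof -
  define J where "J f = (L2norm M f)\<^sup>2 - 2 * Re (l f)" for f
  define m where "m = Inf (J ` Collect (L2 M))"
  have Re_l: "\<bar>Re (l f)\<bar> \<le> C * L2norm M f" if "L2 M f" for f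
    using bdd[OF that] abs_Re_le_cmod[of "l f"] by linarith
  \<comment> \<open>Completing the square: \<open>J f\<close> is at least
    \<open>(L2norm M f - C)^2 - C^2\<close>.\<close>
  have "- C\<^sup>2 \<le> J f" if "L2 M f" for f
  proof -
    have "0 \<le> (L2norm M f - C)\<^sup>2" by simp
    then show ?thesis using Re_l[OF that] unfolding J_def power2_diff by (simp add: mult.commute)
  qed
  then have bb: "bdd_below (J ` Collect (L2 M))" by (intro bdd_belowI[where m = "- C\<^sup>2"]) auto
  have m_le: "m \<le> J f" if "L2 M f" for f
    unfolding m_def by (rule cInf_lower) (use that bb in auto)
  have "\<exists>f. L2 M f \<and> J f < m + inverse (real (Suc n))" for n
  proof -
    have "Inf (J ` Collect (L2 M)) < m + inverse (real (Suc n))" by (simp add: m_def)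
    then have "\<exists>y\<in>J ` Collect (L2 M). y < m + inverse (real (Suc n))"
      using w(1) by (subst (asm) cInf_less_iff[OF _ bb]) auto
    then show ?thesis by auto
  qed
  then obtain f where f: "\<And>n. L2 M (f n)" and Jf: "\<And>n. J (f n) < m + inverse (real (Suc n))"
    by metis
  \<comment> \<open>The parallelogram identity survives the linear term of \<open>J\<close>, because
    that term takes the mean value at the midpoint. Since \<open>J\<close> of the midpoint is at
    least \<open>m\<close>, minimising sequences are Cauchy.\<close>
  have para: "(L2norm M (\<lambda>x. g x - h x))\<^sup>2 = 2 * J g + 2 * J h - 4 * J (\<lambda>x. (1/2) * (g x + h x))"
    if g: "L2 M g" and h: "L2 M h" for g h
  proof -
    have "Re (l (\<lambda>x. (1/2) * (g x + h x))) = (Re (l g) + Re (l h)) / 2"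
      unfolding scale[OF L2_add[OF g h], of "1/2"] add[OF g h] by simp
    moreover have "(L2norm M (\<lambda>x. (1/2) * (g x + h x)))\<^sup>2 = (L2norm M (\<lambda>x. g x + h x))\<^sup>2 / 4"
      unfolding L2norm_scale by (simp add: power_mult_distrib power2_eq_square)
    moreover have "(L2norm M (\<lambda>x. g x + h x))\<^sup>2 = (L2norm M g)\<^sup>2 + 2 * Re (ip M g h) + (L2norm M h)\<^sup>2"
      "(L2norm M (\<lambda>x. g x - h x))\<^sup>2 = (L2norm M g)\<^sup>2 - 2 * Re (ip M g h) + (L2norm M h)\<^sup>2"
      using L2norm_expand[OF g h, of 1] L2norm_expand[OF g h, of "-1"] by simp_all
    ultimately show ?thesis unfolding J_def by argo
  qed
  have Cau: "\<exists>N. \<forall>i\<ge>N. \<forall>j\<ge>N. L2norm M (\<lambda>x. f i x - f j x) < e" if e: "e > 0" for e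
  proof -
    \<comment> \<open>Each of the two values of \<open>J\<close> exceeds \<open>m\<close> by less
      than \<open>e^2 / 4\<close> and enters \<open>para\<close> with factor 2.\<close>
    obtain N where N: "inverse (real (Suc N)) < e\<^sup>2 / 4"
      using reals_Archimedean[of "e\<^sup>2 / 4"] e by auto
    have "L2norm M (\<lambda>x. f i x - f j x) < e" if "i \<ge> N" "j \<ge> N" for i j
    proof -
      have "inverse (real (Suc i)) \<le> inverse (real (Suc N))" "inverse (real (Suc j)) \<le> inverse (real (Suc N))"
        using that by (auto intro!: le_imp_inverse_le)
      then have "(L2norm M (\<lambda>x. f i x - f j x))\<^sup>2 < e\<^sup>2"
        using para[OF f f, of i j] Jf[of i] Jf[of j] m_le[OF L2_scale[OF L2_add[OF f[of i] f[of j]], of "1/2"]] N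
        by linarith
      then show ?thesis by (rule power2_less_imp_less) (use e in simp)
    qed
    then show ?thesis by blast
  qed
  obtain k where k: "L2 M k" and lim: "(\<lambda>n. L2norm M (\<lambda>x. f n x - k x)) \<longlonglongrightarrow> 0"
    using L2_complete[OF w f Cau] by blast
  have Jk: "J k \<le> m"
  proof (rule LIMSEQ_le_const)
    show "(\<lambda>n. m + inverse (real (Suc n)) + (2 * L2norm M k + 2 * C) * L2norm M (\<lambda>x. f n x - k x))
        \<longlonglongrightarrow> m"
      using tendsto_add[OF tendsto_add[OF tendsto_const LIMSEQ_inverse_real_of_nat] tendsto_mult[OF tendsto_const lim], of m "2 * L2norm M k + 2 * C"]
      by simp
    have "J k \<le> m + inverse (real (Suc n)) + (2 * L2norm M k + 2 * C) * L2norm M (\<lambda>x. f n x - k x)" for n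
    proof -
      define d where "d = (\<lambda>x. f n x - k x)"
      have d: "L2 M d" unfolding d_def by (intro L2_diff f k)
      have fn: "f n = (\<lambda>x. k x + 1 * d x)" by (simp add: d_def)
      have "(L2norm M (f n))\<^sup>2 = (L2norm M k)\<^sup>2 + 2 * Re (ip M k d) + (L2norm M d)\<^sup>2"
        unfolding fn by (subst L2norm_expand[OF k d]) simp
      moreover have "\<bar>Re (ip M k d)\<bar> \<le> L2norm M k * L2norm M d"
        using L2_Cauchy_Schwarz[OF k d] abs_Re_le_cmod[of "ip M k d"] by linarith
      moreover have "Re (l (f n)) = Re (l k) + Re (l d)" unfolding fn using add[OF k d] by simp
      moreover have "(2 * L2norm M k + 2 * C) * L2norm M d = 2 * (L2norm M k * L2norm M d) + 2 * (C * L2norm M d)"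
        by (simp add: algebra_simps)
      ultimately show ?thesis
        using Re_l[OF d] Jf[of n] zero_le_power2[of "L2norm M d"]
        unfolding J_def d_def[symmetric] by linarith
    qed
    then show "\<exists>N. \<forall>n\<ge>N. J k \<le> m + inverse (real (Suc n)) + (2 * L2norm M k + 2 * C) * L2norm M (\<lambda>x. f n x - k x)"
      by blast
  qed
  have "l g = ip M g k" if g: "L2 M g" for g
  proof (rule ccontr)
    define e where "e = ip M g k - l g"
    assume "l g \<noteq> ip M g k"
    then have e: "(cmod e)\<^sup>2 > 0" by (simp add: e_def)
    \<comment> \<open>Moving from \<open>k\<close> by \<open>c * g\<close> with
      \<open>c = - t * cnj e\<close> changes \<open>J\<close> by
      \<open>t * (cmod e)^2 * (t * G - 2)\<close>, which is negative once \<open>t * G < 2\<close>;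
      the choice of \<open>t\<close> gives even \<open>t * G < 1\<close>, including the case
      \<open>G = 0\<close>.\<close>
    define G t where "G = (L2norm M g)\<^sup>2" and "t = 1 / (G + 1)"
    have G: "G \<ge> 0" by (simp add: G_def)
    have t: "t > 0" "t * G < 1" using G by (auto simp: t_def divide_less_eq)
    define c where "c = - (of_real t * cnj e)"
    have "J k \<le> J (\<lambda>x. k x + c * g x)"
      using m_le[OF L2_add[OF k L2_scale[OF g]]] Jk by (meson order_trans)
    also have "\<dots> = J k + 2 * Re (cnj c * ip M k g) + (cmod c)\<^sup>2 * G - 2 * Re (c * l g)"
      unfolding J_def by (subst L2norm_expand[OF k g]) (simp add: G_def add[OF k L2_scale[OF g]] scale[OF g])
    also have "Re (cnj c * ip M k g) = Re (c * ip M g k)"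
      by (subst ip_cnj[symmetric]) simp
    finally have "0 \<le> 2 * Re (c * e) + (cmod c)\<^sup>2 * G" by (simp add: e_def algebra_simps)
    also have "c * e = - complex_of_real (t * (cmod e)\<^sup>2)"
      using complex_norm_square[of e] by (simp add: c_def mult_ac)
    also have "(cmod c)\<^sup>2 = t\<^sup>2 * (cmod e)\<^sup>2"
      by (simp add: c_def norm_mult power_mult_distrib)
    finally have "0 \<le> (t * (cmod e)\<^sup>2) * (t * G - 2)"
      by (simp add: algebra_simps power2_eq_square)
    moreover have "t * (cmod e)\<^sup>2 > 0" using e t(1) by (rule mult_pos_pos[rotated])
    ultimately have "0 \<le> t * G - 2" by (metis zero_le_mult_iff not_less)
    then show False using t(2) by simp
  qed
  with k that show thesis by blast
qed

section \<open>Bounded operators between L2 spaces and their adjoints\<close>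

definition L2_op :: "real measure \<Rightarrow> real measure \<Rightarrow> real \<Rightarrow> ((real \<Rightarrow> complex) \<Rightarrow> real \<Rightarrow> complex) \<Rightarrow> bool" where
  "L2_op M N C T \<longleftrightarrow>
    (\<forall>f. L2 M f \<longrightarrow> L2 N (T f)) \<and>
    (\<forall>f g. L2 M f \<longrightarrow> L2 M g \<longrightarrow> (AE s in N. T (\<lambda>t. f t + g t) s = T f s + T g s)) \<and>
    (\<forall>c f. L2 M f \<longrightarrow> (AE s in N. T (\<lambda>t. c * f t) s = c * T f s)) \<and>
    (\<forall>f. L2 M f \<longrightarrow> L2norm N (T f) \<le> C * L2norm M f)"

lemma L2_opD:
  assumes "L2_op M N C T" "L2 M f"
  shows L2_op_L2: "L2 N (T f)"
    and L2_op_add: "L2 M g \<Longrightarrow> AE s in N. T (\<lambda>t. f t + g t) s = T f s + T g s"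
    and L2_op_scale: "AE s in N. T (\<lambda>t. c * f t) s = c * T f s"
    and L2_op_bdd: "L2norm N (T f) \<le> C * L2norm M f"
  using assms unfolding L2_op_def by blast+

lemma L2_op_diff:
  assumes "L2_op M N C T" "L2 M f" "L2 M g"
  shows "AE s in N. T (\<lambda>t. f t - g t) s = T f s - T g s"
  using L2_op_add[OF assms(1,2) L2_scale[OF assms(3), of "-1"]] L2_op_scale[OF assms(1,3), of "-1"]
  by eventually_elim simp

text \<open>Operators act on functions, not on classes. They descend to classes because
  \<open>f - g\<close> has norm zero, so boundedness annihilates its image.\<close>

lemma L2_op_cong:
  assumes T: "L2_op M N C T" and f: "L2 M f" and g: "L2 M g" and eq: "AE t in M. f t = g t"
  shows "AE s in N. T f s = T g s"
proof -
  have d: "L2 M (\<lambda>t. f t - g t)" by (rule L2_diff[OF f g])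
  have "L2norm M (\<lambda>t. f t - g t) = L2norm M (\<lambda>t. 0)"
    by (rule L2norm_cong_AE[OF L2_measurable[OF d]]) (use eq in auto)
  then have "L2norm N (T (\<lambda>t. f t - g t)) \<le> 0"
    using L2_op_bdd[OF T d] by (simp add: L2norm_def)
  then have "AE s in N. T (\<lambda>t. f t - g t) s = 0"
    by (intro L2norm_eq_0 L2_op_L2[OF T d] antisym) auto
  with L2_op_diff[OF T f g] show ?thesis by eventually_elim simp
qed

text \<open>A relation between \<open>T\<close> and \<open>T'\<close>, since \<open>T' g\<close> is
  fixed only up to null sets and any choice of representatives will do.\<close>

definition L2_adj :: "real measure \<Rightarrow> real measure \<Rightarrow> ((real \<Rightarrow> complex) \<Rightarrow> real \<Rightarrow> complex) \<Rightarrow>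
    ((real \<Rightarrow> complex) \<Rightarrow> real \<Rightarrow> complex) \<Rightarrow> bool" where
  "L2_adj M N T T' \<longleftrightarrow> (\<forall>g. L2 N g \<longrightarrow> L2 M (T' g)) \<and>
    (\<forall>f g. L2 M f \<longrightarrow> L2 N g \<longrightarrow> ip N (T f) g = ip M f (T' g))"

lemma L2_adjD:
  assumes "L2_adj M N T T'" "L2 N g"
  shows L2_adj_L2: "L2 M (T' g)"
    and L2_adj_ip: "L2 M f \<Longrightarrow> ip N (T f) g = ip M f (T' g)"
  using assms unfolding L2_adj_def by blast+

text \<open>For each fixed \<open>g\<close> the functional sending \<open>f\<close> to
  \<open>ip N (T f) g\<close> is bounded by Cauchy-Schwarz, and the Riesz theorem represents it by a
  vector that is taken as \<open>T' g\<close>.\<close>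

lemma L2_adj_exists:
  assumes w: "L2 M w" "\<And>x. w x \<noteq> 0" and T: "L2_op M N C T"
  obtains T' where "L2_adj M N T T'"
proof -
  have "\<exists>k. L2 M k \<and> (\<forall>f. L2 M f \<longrightarrow> ip N (T f) g = ip M f k)" if g: "L2 N g" for g
  proof (rule L2_Riesz[OF w, of "\<lambda>f. ip N (T f) g" "C * L2norm N g"])
    fix f h c assume f: "L2 M f" and h: "L2 M h"
    have "ip N (T (\<lambda>x. f x + h x)) g = ip N (\<lambda>s. T f s + T h s) g"
      by (rule ip_cong_AE[OF L2_measurable[OF L2_op_L2[OF T L2_add[OF f h]]]
            L2_measurable[OF L2_add[OF L2_op_L2[OF T f] L2_op_L2[OF T h]]]
            L2_measurable[OF g] L2_measurable[OF g] L2_op_add[OF T f h]]) simp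
    then show "ip N (T (\<lambda>x. f x + h x)) g = ip N (T f) g + ip N (T h) g"
      by (simp add: ip_add_left L2_op_L2[OF T] f h g)
  next
    fix f c assume f: "L2 M f"
    have "ip N (T (\<lambda>x. c * f x)) g = ip N (\<lambda>s. c * T f s) g"
      by (rule ip_cong_AE[OF L2_measurable[OF L2_op_L2[OF T L2_scale[OF f]]]
            L2_measurable[OF L2_scale[OF L2_op_L2[OF T f]]]
            L2_measurable[OF g] L2_measurable[OF g] L2_op_scale[OF T f]]) simp
    then show "ip N (T (\<lambda>x. c * f x)) g = c * ip N (T f) g"
      by (simp add: ip_scale_left)
  next
    fix f assume f: "L2 M f"
    show "cmod (ip N (T f) g) \<le> C * L2norm N g * L2norm M f"
      using L2_Cauchy_Schwarz[OF L2_op_L2[OF T f] g] mult_right_mono[OF L2_op_bdd[OF T f], of "L2norm N g"]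
      by (simp add: mult_ac)
  qed blast
  then obtain T' where "\<And>g. L2 N g \<Longrightarrow> L2 M (T' g) \<and> (\<forall>f. L2 M f \<longrightarrow> ip N (T f) g = ip M f (T' g))"
    by metis
  then have "L2_adj M N T T'" by (auto simp: L2_adj_def)
  then show thesis by (rule that)
qed

lemma L2_adj_norm:
  assumes T': "L2_adj M N T T'" and g: "L2 N g"
  shows "complex_of_real ((L2norm M (T' g))\<^sup>2) = ip N (T (T' g)) g"
  unfolding ip_self[symmetric] by (rule L2_adj_ip[OF T' g L2_adj_L2[OF T' g], symmetric])

text \<open>The square of the norm of \<open>T' g\<close> equals \<open>ip N (T (T' g)) g\<close>,
  hence is at most \<open>C\<close> times the norms of \<open>T' g\<close> and \<open>g\<close>; one
  factor cancels unless it is zero.\<close>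

lemma L2_adj_bound:
  assumes T: "L2_op M N C T" and T': "L2_adj M N T T'" and g: "L2 N g" and C: "C \<ge> 0"
  shows "L2norm M (T' g) \<le> C * L2norm N g"
proof (cases "L2norm M (T' g) = 0")
  case False
  have k: "L2 M (T' g)" by (rule L2_adj_L2[OF T' g])
  have "(L2norm M (T' g))\<^sup>2 = cmod (ip N (T (T' g)) g)"
    unfolding L2_adj_norm[OF T' g, symmetric] norm_of_real by simp
  also have "\<dots> \<le> L2norm N (T (T' g)) * L2norm N g"
    by (rule L2_Cauchy_Schwarz[OF L2_op_L2[OF T k] g])
  also have "\<dots> \<le> C * L2norm M (T' g) * L2norm N g"
    by (rule mult_right_mono[OF L2_op_bdd[OF T k]]) simp
  finally have "L2norm M (T' g) * L2norm M (T' g) \<le> L2norm M (T' g) * (C * L2norm N g)"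
    by (simp add: power2_eq_square mult_ac)
  moreover have "L2norm M (T' g) > 0" using False L2norm_nonneg[of M "T' g"] by linarith
  ultimately show ?thesis by simp
qed (use C in simp)


section \<open>Uniqueness of the Cauchy transform\<close>

text \<open>The image of the constant 1 under the resolvent of multiplication by the
  variable.\<close>

definition cker :: "complex \<Rightarrow> real \<Rightarrow> complex" where
  "cker z t = 1 / (complex_of_real t - z)"

lemma of_real_diff_nonzero:
  assumes "Im z \<noteq> 0"
  shows "complex_of_real t - z \<noteq> 0"
proof
  assume h: "complex_of_real t - z = 0"
  have "Im (complex_of_real t - z) = 0" unfolding h by simp
  then show False using assms by simp
qed

lemma cker_nonzero: "Im z \<noteq> 0 \<Longrightarrow> cker z t \<noteq> 0"
  using of_real_diff_nonzero[of z t] by (simp add: cker_def)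

lemma cker_measurable [measurable]: "cker z \<in> borel_measurable borel"
  unfolding cker_def by measurable

lemma cker_bound: "Im z \<noteq> 0 \<Longrightarrow> cmod (cker z t) \<le> 1 / \<bar>Im z\<bar>"
  using abs_Im_le_cmod[of "complex_of_real t - z"] of_real_diff_nonzero[of z t]
  by (auto simp: cker_def norm_divide intro!: divide_left_mono mult_pos_pos)

lemma cker_cnj: "cnj (cker z t) = cker (cnj z) t"
  by (simp add: cker_def)

text \<open>The resolvent identity in scalar form; it turns Cauchy transforms of
  \<open>k * cker z\<close> into divided differences of those of \<open>k\<close>.\<close>

lemma cker_mult:
  assumes "Im z \<noteq> 0" "Im w \<noteq> 0" "z \<noteq> w"
  shows "cker z t * cker w t = (cker z t - cker w t) / (z - w)"
  using assms of_real_diff_nonzero[of z t] of_real_diff_nonzero[of w t]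
  by (simp add: cker_def divide_simps)

text \<open>The quotient of \<open>cker z\<close> by \<open>cker \<i>\<close> is
  \<open>1 + (z - \<i>) * cker z\<close>, which is bounded. This serves the measure \<nu>, where
  membership of the single kernel \<open>cker \<i>\<close> is established and decay is not
  integrated directly.\<close>

lemma L2_cker:
  assumes "sets M = sets borel" "L2 M (cker \<i>)" "Im z \<noteq> 0"
  shows "L2 M (cker z)"
proof (rule L2_bound[OF assms(2)])
  show "cker z \<in> borel_measurable M"
    using assms(1) cker_measurable measurable_cong_sets by blast
  have "cmod (cker z t) \<le> (1 + cmod (z - \<i>) / \<bar>Im z\<bar>) * cmod (cker \<i> t)" for t
  proof -
    have "cker z t = (1 + (z - \<i>) * cker z t) * cker \<i> t"
      using of_real_diff_nonzero[OF assms(3), of t] of_real_diff_nonzero[of \<i> t]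
      by (simp add: cker_def field_simps)
    then have "cmod (cker z t) = cmod (1 + (z - \<i>) * cker z t) * cmod (cker \<i> t)"
      by (metis norm_mult)
    also have "\<dots> \<le> (1 + cmod (z - \<i>) / \<bar>Im z\<bar>) * cmod (cker \<i> t)"
    proof (rule mult_right_mono)
      have "cmod (1 + (z - \<i>) * cker z t) \<le> 1 + cmod (z - \<i>) * cmod (cker z t)"
        using norm_triangle_ineq[of 1 "(z - \<i>) * cker z t"] by (simp add: norm_mult)
      also have "\<dots> \<le> 1 + cmod (z - \<i>) * (1 / \<bar>Im z\<bar>)"
        by (intro add_left_mono mult_left_mono cker_bound assms) simp
      finally show "cmod (1 + (z - \<i>) * cker z t) \<le> 1 + cmod (z - \<i>) / \<bar>Im z\<bar>" by simp
    qed simp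
    finally show ?thesis .
  qed
  then show "AE t in M. cmod (cker z t) \<le> (1 + cmod (z - \<i>) / \<bar>Im z\<bar>) * cmod (cker \<i> t)" by simp
qed

text \<open>By Markov's inequality the sets where \<open>f\<close> is at least 1/(n+1) have finite
  measure, and positivity makes them exhaust the space. It is applied to the squared modulus of
  \<open>cker \<i>\<close>.\<close>

lemma sigma_finite_measure_if_pos_integrable:
  fixes f :: "'a \<Rightarrow> real"
  assumes f: "integrable M f" "\<And>x. x \<in> space M \<Longrightarrow> f x > 0"
  shows "sigma_finite_measure M"
proof
  define A where "A n = {x\<in>space M. f x \<ge> inverse (real (Suc n))}" for n
  have "A n \<in> sets M" for n using f(1) unfolding A_def by measurable
  moreover have "(\<Union>n. A n) = space M"
  proof (auto simp: A_def)
    fix x assume "x \<in> space M"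
    then show "\<exists>n. inverse (1 + real n) \<le> f x"
      using reals_Archimedean[OF f(2)] by (auto intro: less_imp_le)
  qed
  moreover have "emeasure M (A n) \<noteq> \<infinity>" for n
  proof -
    have "emeasure M (A n) \<le> (1 / inverse (real (Suc n))) * (\<integral>x. f x \<partial>M)"
      unfolding A_def
      by (rule integral_Markov_inequality[OF f(1)]) (use f(2) in \<open>auto intro: less_imp_le\<close>)
    then show ?thesis by (auto simp: top_unique)
  qed
  ultimately show "\<exists>A. countable A \<and> A \<subseteq> sets M \<and> \<Union>A = space M \<and> (\<forall>a\<in>A. emeasure M a \<noteq> \<infinity>)"
    by (intro exI[of _ "range A"]) auto
qed

section \<open>Jump of the Cauchy kernel across the real axis and Stieltjes inversion\<close>

lemma cker_Poisson:
  assumes "y > 0"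
  shows "cker (Complex x y) s - cker (Complex x (- y)) s = 2 * \<i> * complex_of_real (y / ((s - x)\<^sup>2 + y\<^sup>2))"
proof -
  have prod: "(complex_of_real s - Complex x y) * (complex_of_real s - Complex x (-y))
      = complex_of_real ((s - x)\<^sup>2 + y\<^sup>2)"
    by (simp add: complex_eq_iff power2_eq_square algebra_simps)
  have nz: "complex_of_real s - Complex x y \<noteq> 0" "complex_of_real s - Complex x (-y) \<noteq> 0"
    using assms of_real_diff_nonzero[of "Complex x y" s] of_real_diff_nonzero[of "Complex x (- y)" s] by simp_all
  have "cker (Complex x y) s - cker (Complex x (- y)) s
      = ((complex_of_real s - Complex x (-y)) - (complex_of_real s - Complex x y)) / complex_of_real ((s - x)\<^sup>2 + y\<^sup>2)"
    unfolding cker_def prod[symmetric] using nz by (subst diff_frac_eq) simp_all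
  also have "(complex_of_real s - Complex x (-y)) - (complex_of_real s - Complex x y) = 2 * \<i> * complex_of_real y"
    by (simp add: complex_eq_iff)
  finally show ?thesis by simp
qed

text \<open>With \<open>N = n + 1\<close> the argument is \<open>(c + 1/N) / (1/N^2)\<close>. The
  summand \<open>N\<close> is dominated by the quadratic term unless \<open>c = 0\<close>, where it
  sends the arctangent to \<open>pi / 2\<close> instead of 0.\<close>

lemma arctan_shift_limit:
  fixes c :: real
  shows "(\<lambda>n. arctan ((real (Suc n))\<^sup>2 * c + real (Suc n))) \<longlonglongrightarrow> (if 0 \<le> c then pi / 2 else - (pi / 2))"
proof (cases "0 \<le> c")
  case True
  have "filterlim (\<lambda>n. (real (Suc n))\<^sup>2 * c + real (Suc n)) at_top sequentially"
  proof (rule filterlim_at_top_mono)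
    show "filterlim (\<lambda>n. real (Suc n)) at_top sequentially"
      by (rule filterlim_compose[OF filterlim_real_sequentially filterlim_Suc])
  qed (use True in auto)
  then show ?thesis
    using filterlim_compose[OF tendsto_arctan_at_top] True by auto
next
  case False
  have "filterlim (\<lambda>n. (real (Suc n))\<^sup>2 * c + real (Suc n)) at_bot sequentially"
  proof (rule filterlim_at_bot_mono[of "\<lambda>n. - real (Suc n)"])
    show "filterlim (\<lambda>n. - real (Suc n)) at_bot sequentially"
      by (intro filterlim_uminus_at_bot_at_top[THEN filterlim_compose]
          filterlim_compose[OF filterlim_real_sequentially filterlim_Suc])
    \<comment> \<open>Beyond this index the negative quadratic term exceeds twice the linear one in
      modulus.\<close>
    obtain K :: nat where K: "2 / (- c) < real K" using reals_Archimedean2 by blast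
    show "\<forall>\<^sub>F n in sequentially. (real (Suc n))\<^sup>2 * c + real (Suc n) \<le> - real (Suc n)"
      using eventually_ge_at_top[of K]
    proof eventually_elim
      case (elim n)
      have "2 < real K * (- c)" using K False by (simp only: pos_divide_less_eq)
      also have "\<dots> \<le> real (Suc n) * (- c)" using elim False by (intro mult_right_mono) auto
      finally have "2 < real (Suc n) * (- c)" .
      then have "real (Suc n) * 2 \<le> real (Suc n) * (real (Suc n) * (- c))"
        by (intro mult_left_mono) auto
      then show ?case by (simp add: power2_eq_square algebra_simps)
    qed
  qed
  then show ?thesis
    using filterlim_compose[OF tendsto_arctan_at_bot] False by auto
qed

lemma integral_Poisson_kernel:
  fixes y :: real
  assumes "y > 0" "a \<le> b"
  shows "(\<integral>x. indicator {a..b} x *\<^sub>R (y / ((s - x)\<^sup>2 + y\<^sup>2)) \<partial>lborel) = arctan ((b - s) / y) - arctan ((a - s) / y)"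
proof (rule integral_FTC_atLeastAtMost[OF assms(2), where F = "\<lambda>x. arctan ((x - s) / y)"])
  fix x
  have "((\<lambda>x. arctan ((x - s) / y)) has_real_derivative (1 / y) * inverse (1 + ((x - s) / y)\<^sup>2)) (at x within {a..b})"
    using assms by (auto intro!: derivative_eq_intros simp: field_simps)
  moreover have "(1 / y) * inverse (1 + ((x - s) / y)\<^sup>2) = y / ((s - x)\<^sup>2 + y\<^sup>2)"
  proof -
    have "(s - x)\<^sup>2 + y\<^sup>2 > 0" "1 + ((x - s) / y)\<^sup>2 > 0" using assms by (auto intro: add_nonneg_pos add_pos_nonneg)
    moreover have "(1 + ((x - s) / y)\<^sup>2) * y\<^sup>2 = (s - x)\<^sup>2 + y\<^sup>2"
      using assms by (simp add: distrib_right power_divide power2_commute)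
    ultimately show ?thesis using assms by (simp add: field_simps power2_eq_square)
  qed
  ultimately show "((\<lambda>x. arctan ((x - s) / y)) has_vector_derivative y / ((s - x)\<^sup>2 + y\<^sup>2)) (at x within {a..b})"
    by (simp add: has_real_derivative_iff_has_vector_derivative)
next
  have "(s - x)\<^sup>2 + y\<^sup>2 \<noteq> 0" for x using assms by (simp add: sum_power2_eq_zero_iff)
  then show "continuous_on {a..b} (\<lambda>x. y / ((s - x)\<^sup>2 + y\<^sup>2))"
    by (intro continuous_intros) auto
qed

text \<open>Half-open intervals form an intersection-stable generator, so induction over complements
  and disjoint unions applies. The complement case needs the integral over the whole line, obtained
  from the intervals (-n, n] by dominated convergence.\<close>

lemma integral_zero_if_intervals:
  fixes k :: "real \<Rightarrow> complex"
  assumes sets: "sets M = sets borel" and k: "integrable M k"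
    and Ioc: "\<And>a b. a \<le> b \<Longrightarrow> (LINT x:{a<..b}|M. k x) = 0" and A: "A \<in> sets M"
  shows "(LINT x:A|M. k x) = 0"
proof -
  note [measurable_cong] = sets
  have sp: "space M = UNIV" using sets_eq_imp_space_eq[OF sets] by simp
  have km [measurable]: "k \<in> borel_measurable M" using k by auto
  have si: "set_integrable M B k" if "B \<in> sets borel" for B
    unfolding set_integrable_def using that sets k by (intro integrable_mult_indicator) auto
  have tot: "(LINT x:UNIV|M. k x) = 0"
  proof -
    have "(\<lambda>n. LINT x|M. indicator {- real n<..real n} x *\<^sub>R k x) \<longlonglongrightarrow> (LINT x|M. indicator UNIV x *\<^sub>R k x)"
    proof (rule integral_dominated_convergence[where w = "\<lambda>x. norm (k x)"])
      show "AE x in M. (\<lambda>n. indicator {- real n<..real n} x *\<^sub>R k x) \<longlonglongrightarrow> indicator UNIV x *\<^sub>R k x"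
      proof (rule AE_I2)
        fix x :: real
        obtain K :: nat where K: "\<bar>x\<bar> < real K" using reals_Archimedean2 by blast
        have "\<forall>\<^sub>F n in sequentially. indicator {- real n<..real n} x *\<^sub>R k x = indicator UNIV x *\<^sub>R k x"
          using eventually_ge_at_top[of K] by eventually_elim (use K in \<open>auto simp: indicator_def\<close>)
        then show "(\<lambda>n. indicator {- real n<..real n} x *\<^sub>R k x) \<longlonglongrightarrow> indicator UNIV x *\<^sub>R k x"
          by (rule tendsto_eventually)
      qed
    qed (use k in \<open>auto simp: indicator_def\<close>)
    then show ?thesis using Ioc by (simp add: set_lebesgue_integral_def LIMSEQ_const_iff)
  qed
  let ?G = "range (\<lambda>(a, b). {a<..b::real})"
  have Int: "Int_stable ?G"
  proof (rule Int_stableI, clarify)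
    fix a b c d :: real
    have "{a<..b} \<inter> {c<..d} = {max a c<..min b d}" by auto
    then show "{a<..b} \<inter> {c<..d} \<in> ?G" by (auto intro!: image_eqI[of _ _ "(max a c, min b d)"])
  qed
  have sub: "?G \<subseteq> Pow UNIV" by simp
  have "A \<in> sigma_sets UNIV ?G"
    using A sets borel_sigma_sets_Ioc by (metis sets_measure_of subset_UNIV Pow_UNIV)
  from Int sub this show ?thesis
  proof (induction rule: sigma_sets_induct_disjoint)
    case (basic B)
    then obtain a b where "B = {a<..b}" by auto
    then show ?case using Ioc[of a b] by (cases "a \<le> b") (auto simp: set_lebesgue_integral_def)
  next
    case empty
    show ?case by (simp add: set_lebesgue_integral_def)
  next
    case (compl B)
    then have B: "B \<in> sets borel" by (metis borel_sigma_sets_Ioc sets_measure_of subset_UNIV Pow_UNIV)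
    have "(LINT x:B \<union> (UNIV - B)|M. k x) = (LINT x:B|M. k x) + (LINT x:UNIV - B|M. k x)"
      by (rule set_integral_Un) (use B si in auto)
    then show ?case using compl tot by simp
  next
    case (union B)
    then have B: "B i \<in> sets borel" for i
      by (metis borel_sigma_sets_Ioc sets_measure_of subset_UNIV Pow_UNIV range_subsetD)
    have "(LINT x:(\<Union>i. B i)|M. k x) = (\<Sum>i. LINT x:B i|M. k x)"
      by (rule lebesgue_integral_countable_add) (use B si union sets in \<open>auto simp: disjoint_family_on_def\<close>)
    then show ?case using union by simp
  qed
qed

text \<open>Integrating the Poisson kernel over \<open>[a, b]\<close> gives a difference of arctangents; shifting the
  interval by \<open>sqrt y\<close> makes it converge, endpoints included, to \<open>\<pi>\<close> times the indicator of \<open>(a, b]\<close>.\<close>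
lemma Cauchy_transform_unique:
  fixes k :: "real \<Rightarrow> complex"
  assumes sf: "sigma_finite_measure M" and sets: "sets M = sets borel" and k: "integrable M k"
    and d: "d > 0" and zero: "\<And>w. Im w \<noteq> 0 \<Longrightarrow> \<bar>Im w\<bar> < d \<Longrightarrow> (\<integral>t. k t * cker w t \<partial>M) = 0"
  shows "AE t in M. k t = 0"
proof -
  interpret sigma_finite_measure M by (rule sf)
  interpret pair_sigma_finite lborel M ..
  note [measurable_cong] = sets
  have [measurable]: "k \<in> borel_measurable M" using k by auto
  define P where "P y s x = y / ((s - x)\<^sup>2 + y\<^sup>2)" for y s x :: real
  \<comment> \<open>With \<open>x\<close> confined to a bounded interval, this bound makes the
    double integral absolutely convergent, as Fubini's theorem requires.\<close>
  have P_bd: "\<bar>P y s x\<bar> \<le> 1 / y" if "y > 0" for y s x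
  proof -
    have "y / ((s - x)\<^sup>2 + y\<^sup>2) \<le> y / y\<^sup>2"
      by (rule divide_left_mono) (use that in \<open>auto simp: add_nonneg_pos\<close>)
    then show ?thesis using that by (simp add: P_def power2_eq_square)
  qed
  have P_zero: "(\<integral>s. complex_of_real (P y s x) * k s \<partial>M) = 0" if "0 < y" "y < d" for x y
  proof -
    have i: "integrable M (\<lambda>s. k s * cker w s)" if "Im w \<noteq> 0" for w
      by (rule Bochner_Integration.integrable_bound[of M "\<lambda>s. (1 / \<bar>Im w\<bar>) *\<^sub>R k s"])
         (use k mult_left_mono[OF cker_bound[OF that], of "cmod (k _)"] in \<open>auto simp: norm_mult\<close>)
    have "(\<integral>s. complex_of_real (P y s x) * k s \<partial>M)
        = (\<integral>s. (k s * cker (Complex x y) s - k s * cker (Complex x (-y)) s) / (2 * \<i>) \<partial>M)"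
      unfolding right_diff_distrib[symmetric] cker_Poisson[OF that(1)] P_def[symmetric] by (simp add: mult.commute)
    also have "\<dots> = 0"
      using that by (simp add: i zero)
    finally show ?thesis .
  qed
  have arc: "(\<integral>s. complex_of_real (arctan ((b - s) / y) - arctan ((a - s) / y)) * k s \<partial>M) = 0"
    if y: "0 < y" "y < d" and ab: "a \<le> b" for y a b
  proof -
    define F where "F x s = indicator {a..b} x *\<^sub>R (complex_of_real (P y s x) * k s)" for x s
    have Fm [measurable]: "case_prod F \<in> borel_measurable (lborel \<Otimes>\<^sub>M M)"
      unfolding F_def P_def by measurable
    have intF: "integrable (lborel \<Otimes>\<^sub>M M) (case_prod F)"
    proof (rule Bochner_Integration.integrable_bound)
      show "integrable (lborel \<Otimes>\<^sub>M M) (\<lambda>(x, s). (indicator {a..b} x / y) *\<^sub>R k s)"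
      proof (rule Fubini_integrable)
        have "integrable lborel (\<lambda>x. indicator {a..b} x *\<^sub>R ((1 / y) * (\<integral>s. cmod (k s) \<partial>M)))"
          by (rule borel_integrable_compact) auto
        then show "integrable lborel (\<lambda>x. \<integral>s. norm (case (x, s) of (x, s) \<Rightarrow> (indicator {a..b} x / y) *\<^sub>R k s) \<partial>M)"
          using y by (simp add: abs_mult)
      qed (use k in auto)
      show "AE p in lborel \<Otimes>\<^sub>M M. norm (case_prod F p) \<le> norm (case p of (x, s) \<Rightarrow> (indicator {a..b} x / y) *\<^sub>R k s)"
      proof (rule AE_I2, clarify)
        fix x s
        show "norm (F x s) \<le> norm ((indicator {a..b} x / y) *\<^sub>R k s)"
          using mult_right_mono[OF P_bd[OF y(1), of s x], of "cmod (k s)"] y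
          by (auto simp: F_def indicator_def norm_mult)
      qed
    qed simp
    have "(\<integral>s. (\<integral>x. F x s \<partial>lborel) \<partial>M) = (\<integral>x. (\<integral>s. F x s \<partial>M) \<partial>lborel)"
      by (rule Fubini_integral[OF intF])
    moreover have "(\<integral>x. F x s \<partial>lborel) = complex_of_real (arctan ((b - s) / y) - arctan ((a - s) / y)) * k s" for s
    proof -
      have "F x s = complex_of_real (indicator {a..b} x *\<^sub>R P y s x) * k s" for x
        by (simp add: F_def indicator_def)
      then show ?thesis
        using integral_Poisson_kernel[OF y(1) ab, of s, folded P_def]
        by (simp only: integral_mult_left_zero integral_complex_of_real)
    qed
    moreover have "(\<integral>s. F x s \<partial>M) = 0" for x
      unfolding F_def using P_zero[OF y, of x] by simp
    ultimately show ?thesis by simp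
  qed
  have "(LINT x:{a<..b}|M. k x) = 0" if ab: "a \<le> b" for a b
  proof -
    \<comment> \<open>For \<open>N = n + 1\<close> this is the arctangent difference of
      \<open>arc\<close> at height \<open>y = 1/N^2\<close> for the endpoints \<open>a + 1/N\<close>
      and \<open>b + 1/N\<close>, since
      \<open>(e + 1/N - s) / y = N^2 * (e - s) + N\<close>.\<close>
    define c where "c n s = arctan ((real (Suc n))\<^sup>2 * (b - s) + real (Suc n)) - arctan ((real (Suc n))\<^sup>2 * (a - s) + real (Suc n))" for n s
    have "(\<lambda>n. \<integral>s. complex_of_real (c n s) * k s \<partial>M) \<longlonglongrightarrow> (\<integral>s. complex_of_real (pi * indicator {a<..b} s) * k s \<partial>M)"
    proof (rule integral_dominated_convergence[where w = "\<lambda>s. pi * cmod (k s)"])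
      have "(\<lambda>n. c n s) \<longlonglongrightarrow> pi * indicator {a<..b} s" for s
      proof -
        have "(\<lambda>n. c n s) \<longlonglongrightarrow> (if 0 \<le> b - s then pi / 2 else - (pi / 2)) - (if 0 \<le> a - s then pi / 2 else - (pi / 2))"
          unfolding c_def by (intro tendsto_diff arctan_shift_limit)
        moreover have "(if 0 \<le> b - s then pi / 2 else - (pi / 2)) - (if 0 \<le> a - s then pi / 2 else - (pi / 2)) = pi * indicator {a<..b} s"
          using ab by (auto simp: indicator_def)
        ultimately show ?thesis by simp
      qed
      then show "AE s in M. (\<lambda>n. complex_of_real (c n s) * k s) \<longlonglongrightarrow> complex_of_real (pi * indicator {a<..b} s) * k s"
        by (intro AE_I2 tendsto_intros)
      show "AE s in M. norm (complex_of_real (c n s) * k s) \<le> pi * cmod (k s)" for n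
      proof (rule AE_I2)
        fix s
        have "\<bar>c n s\<bar> \<le> pi"
          using arctan_bounded[of "(real (Suc n))\<^sup>2 * (b - s) + real (Suc n)"] arctan_bounded[of "(real (Suc n))\<^sup>2 * (a - s) + real (Suc n)"]
          unfolding c_def by linarith
        then show "norm (complex_of_real (c n s) * k s) \<le> pi * cmod (k s)"
          by (simp add: norm_mult mult_right_mono)
      qed
      show "integrable M (\<lambda>s. pi * cmod (k s))" using k by simp
    qed (simp_all add: c_def)
    moreover have "\<forall>\<^sub>F n in sequentially. (\<integral>s. complex_of_real (c n s) * k s \<partial>M) = 0"
    proof -
      have "\<forall>\<^sub>F n in sequentially. inverse (real (Suc n)) < d"
        using LIMSEQ_inverse_real_of_nat d by (simp add: order_tendsto_iff)
      then show ?thesis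
      proof eventually_elim
        case (elim n)
        define y where "y = inverse ((real (Suc n))\<^sup>2)"
        have y: "y > 0" by (simp add: y_def)
        have "real (Suc n) \<le> (real (Suc n))\<^sup>2" by (simp add: power2_eq_square)
        then have "y \<le> inverse (real (Suc n))" unfolding y_def by (intro le_imp_inverse_le) auto
        then have "y < d" using elim by simp
        moreover have "(e + inverse N - s) / inverse (N\<^sup>2) = N\<^sup>2 * (e - s) + N" if "N > 0" for e s N :: real
          using that by (simp add: field_simps power2_eq_square)
        from this[of "real (Suc n)"]
        have "(e + inverse (real (Suc n)) - s) / y = (real (Suc n))\<^sup>2 * (e - s) + real (Suc n)" for e s
          unfolding y_def by (simp del: of_nat_Suc)
        ultimately show ?case
          using arc[OF y \<open>y < d\<close>, of "a + inverse (real (Suc n))" "b + inverse (real (Suc n))"] ab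
          by (simp add: c_def)
      qed
    qed
    then have "(\<lambda>n. \<integral>s. complex_of_real (c n s) * k s \<partial>M) \<longlonglongrightarrow> 0"
      by (rule tendsto_eventually)
    ultimately have "(\<integral>s. complex_of_real (pi * indicator {a<..b} s) * k s \<partial>M) = 0"
      by (rule LIMSEQ_unique)
    moreover have "complex_of_real (pi * indicator {a<..b} s) * k s = of_real pi * (indicator {a<..b} s *\<^sub>R k s)" for s
      by (simp add: indicator_def)
    ultimately have "complex_of_real pi * (\<integral>s. indicator {a<..b} s *\<^sub>R k s \<partial>M) = 0"
      by (simp only: integral_mult_right_zero)
    then show ?thesis by (simp add: set_lebesgue_integral_def)
  qed
  then have "(LINT x:A|M. k x) = 0" if "A \<in> sets M" for A
    using integral_zero_if_intervals[OF sets k] that by blast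
  then show ?thesis by (rule sigma_finite_measure.density_zero[OF sf k])
qed

text \<open>An L2 function need not be integrable, but its product with a kernel is, and the
  resolvent identity shows that the product also has vanishing Cauchy transform. Demanding zeros
  only in a strip allows applications in which \<open>w\<close> has to stay away from a given
  point.\<close>

lemma L2_Cauchy_transform_unique:
  assumes sets: "sets M = sets borel" and base: "L2 M (cker \<i>)" and k: "L2 M k"
    and d: "d > 0" and zero: "\<And>w. Im w \<noteq> 0 \<Longrightarrow> \<bar>Im w\<bar> < d \<Longrightarrow> (\<integral>t. k t * cker w t \<partial>M) = 0"
  shows "AE t in M. k t = 0"
proof -
  have sf: "sigma_finite_measure M"
    by (rule sigma_finite_measure_if_pos_integrable[OF L2_integrable[OF base]]) (simp add: cker_nonzero)
  \<comment> \<open>At height \<open>d / 2\<close> the point lies inside the strip yet differs from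
    every \<open>w\<close> with \<open>\<bar>Im w\<bar> < d / 4\<close>.\<close>
  define z where "z = Complex 0 (d / 2)"
  have z: "Im z \<noteq> 0" "\<bar>Im z\<bar> < d" using d by (auto simp: z_def)
  have "AE t in M. k t * cker z t = 0"
  proof (rule Cauchy_transform_unique[OF sf sets])
    show "integrable M (\<lambda>t. k t * cker z t)"
      by (rule L2_prod_integrable[OF k L2_cker[OF sets base z(1)]])
    show "d / 4 > 0" using d by simp
    fix w assume w: "Im w \<noteq> 0" "\<bar>Im w\<bar> < d / 4"
    then have "z \<noteq> w" using d by (auto simp: z_def)
    have i: "integrable M (\<lambda>t. k t * cker v t)" if "Im v \<noteq> 0" for v
      by (rule L2_prod_integrable[OF k L2_cker[OF sets base that]])
    have "(\<integral>t. k t * cker z t * cker w t \<partial>M) = (\<integral>t. (k t * cker z t - k t * cker w t) / (z - w) \<partial>M)"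
      by (intro Bochner_Integration.integral_cong refl)
         (simp add: mult.assoc cker_mult[OF z(1) w(1) \<open>z \<noteq> w\<close>] right_diff_distrib)
    also have "\<dots> = 0" using zero[OF z] zero[OF w(1)] w(2) d by (simp add: i z w)
    finally show "(\<integral>t. k t * cker z t * cker w t \<partial>M) = 0" .
  qed
  then show ?thesis using cker_nonzero[OF z(1)] by auto
qed

section \<open>The operator on Cauchy kernels\<close>

definition possq :: "real \<Rightarrow> real" where
  "possq x = (max 0 x)\<^sup>2"

lemma possq_nonneg: "0 \<le> possq x"
  by (simp add: possq_def)

text \<open>For all sign combinations the remainder of the first order expansion is at most
  \<open>(y - x)^2\<close>, so the kink of the positive part at 0 is covered together with all other
  points.\<close>

lemma possq_deriv: "(possq has_real_derivative 2 * max 0 x) (at x)"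
proof -
  have bd: "\<bar>(possq y - possq x) / (y - x) - 2 * max 0 x\<bar> \<le> \<bar>y - x\<bar>" if "y \<noteq> x" for y
  proof -
    have "\<bar>possq y - possq x - 2 * max 0 x * (y - x)\<bar> \<le> (y - x)\<^sup>2"
    proof (cases "0 \<le> x"; cases "0 \<le> y")
      assume "0 \<le> x" "\<not> 0 \<le> y"
      moreover from this have "x * y \<le> 0" by (intro mult_nonneg_nonpos) auto
      then have "\<bar>x * x - x * (y * 2)\<bar> = x * x - x * (y * 2)"
        using zero_le_square[of x] by (intro abs_of_nonneg) linarith
      ultimately show ?thesis by (simp add: possq_def power2_eq_square algebra_simps)
    next
      assume "\<not> 0 \<le> x" "0 \<le> y"
      moreover from this have "x * y \<le> 0" by (intro mult_nonpos_nonneg) auto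
      ultimately show ?thesis by (simp add: possq_def power2_eq_square algebra_simps abs_le_iff)
    qed (use zero_le_square[of "y - x"] in \<open>simp_all add: possq_def power2_eq_square algebra_simps abs_le_iff\<close>)
    then have "\<bar>possq y - possq x - 2 * max 0 x * (y - x)\<bar> / \<bar>y - x\<bar> \<le> (y - x)\<^sup>2 / \<bar>y - x\<bar>"
      by (rule divide_right_mono) simp
    also have "(y - x)\<^sup>2 / \<bar>y - x\<bar> = \<bar>y - x\<bar>"
    proof -
      have "(y - x)\<^sup>2 = \<bar>y - x\<bar> * \<bar>y - x\<bar>" by (simp add: power2_eq_square)
      moreover have "\<bar>y - x\<bar> \<noteq> 0" using that by simp
      ultimately show ?thesis by (metis nonzero_mult_div_cancel_right)
    qed
    also have "\<bar>possq y - possq x - 2 * max 0 x * (y - x)\<bar> / \<bar>y - x\<bar> = \<bar>(possq y - possq x) / (y - x) - 2 * max 0 x\<bar>"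
      using that by (simp add: diff_divide_distrib flip: abs_divide)
    finally show ?thesis .
  qed
  have "((\<lambda>y. (possq y - possq x) / (y - x) - 2 * max 0 x) \<longlongrightarrow> 0) (at x)"
  proof (rule Lim_null_comparison)
    show "\<forall>\<^sub>F y in at x. norm ((possq y - possq x) / (y - x) - 2 * max 0 x) \<le> \<bar>y - x\<bar>"
      using bd by (auto simp: eventually_at_filter)
    have "((\<lambda>y. \<bar>y - x\<bar>) \<longlongrightarrow> \<bar>x - x\<bar>) (at x)" by (intro tendsto_intros)
    then show "((\<lambda>y. \<bar>y - x\<bar>) \<longlongrightarrow> 0) (at x)" by simp
  qed
  then show ?thesis unfolding has_field_derivative_iff by (simp add: LIM_zero_iff)
qed

lemma possq_deriv_chain [derivative_intros]:
  assumes "(f has_real_derivative f') (at x within S)"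
  shows "((\<lambda>x. possq (f x)) has_real_derivative (2 * max 0 (f x)) * f') (at x within S)"
  by (rule DERIV_chain2[OF possq_deriv assms])

lemma continuous_on_possq [continuous_intros]:
  "continuous_on S f \<Longrightarrow> continuous_on S (\<lambda>x. possq (f x))"
  unfolding possq_def by (intro continuous_intros)

text \<open>The inner terms start to grow at \<open>t = N\<close> and \<open>t = -N\<close> and
  reach 1 at twice that distance; the outer \<open>possq\<close> then truncates at 0 without losing
  differentiability. The result is 1 on [-N, N] and 0 outside (-2N, 2N).\<close>

definition cutoff :: "real \<Rightarrow> real \<Rightarrow> real" where
  "cutoff N t = possq (1 - possq (t / N - 1) - possq (- (t / N) - 1))"

lemma cutoff_range: "0 \<le> cutoff N t" "cutoff N t \<le> 1"
proof -
  show "0 \<le> cutoff N t" by (simp add: cutoff_def possq_def)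
  have "max 0 (1 - possq (t / N - 1) - possq (- (t / N) - 1)) \<le> 1"
    using possq_nonneg[of "t / N - 1"] possq_nonneg[of "- (t / N) - 1"] by (simp add: max_def)
  then have "(max 0 (1 - possq (t / N - 1) - possq (- (t / N) - 1)))\<^sup>2 \<le> 1"
    by (intro power_le_one) auto
  then show "cutoff N t \<le> 1" by (simp add: cutoff_def possq_def)
qed

lemma cutoff_eq_1:
  assumes "\<bar>t\<bar> \<le> N" shows "cutoff N t = 1"
proof -
  have "\<bar>t / N\<bar> \<le> 1" using assms by (auto simp: abs_divide divide_le_eq_1)
  then have "t / N \<le> 1" "- (t / N) \<le> 1" by linarith+
  then show ?thesis by (simp add: cutoff_def possq_def max_def)
qed

lemma cutoff_eq_0:
  assumes "\<bar>t\<bar> \<ge> 2 * N" "N > 0" shows "cutoff N t = 0"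
proof -
  have "1 \<le> t / N - 1 \<or> 1 \<le> - (t / N) - 1"
    using assms by (auto simp: field_simps abs_if split: if_splits)
  then have "1 \<le> possq (t / N - 1) \<or> 1 \<le> possq (- (t / N) - 1)"
    unfolding possq_def by (auto intro: one_le_power)
  then have "1 - possq (t / N - 1) - possq (- (t / N) - 1) \<le> 0"
    using possq_nonneg[of "t / N - 1"] possq_nonneg[of "- (t / N) - 1"] by linarith
  then show ?thesis unfolding cutoff_def possq_def[of "1 - _ - _"] by (simp add: max_def)
qed

section \<open>Action of V and of its extension on Cauchy kernels\<close>

lemma cker_deriv:
  assumes "Im z \<noteq> 0"
  shows "(cker z has_vector_derivative - (cker z t * cker z t)) (at t within S)"
proof -
  have "((\<lambda>w. 1 / (w - z)) has_field_derivative - (cker z t * cker z t)) (at (complex_of_real t))"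
    using of_real_diff_nonzero[OF assms, of t]
    by (auto intro!: derivative_eq_intros simp: cker_def)
  then show ?thesis unfolding cker_def by (rule has_vector_derivative_real_field)
qed

lemma cker_continuous:
  assumes "Im z \<noteq> 0"
  shows "continuous_on S (cker z)"
  unfolding cker_def using of_real_diff_nonzero[OF assms] by (intro continuous_intros) auto

lemma C1c_cutoff_cker:
  assumes N: "N > 0" and z: "Im z \<noteq> 0"
  shows "C1c (\<lambda>t. complex_of_real (cutoff N t) * cker z t)"
  unfolding C1c_def
proof
  define D where "D t = 2 * max 0 (1 - possq (t / N - 1) - possq (- (t / N) - 1)) *
      (- (2 * max 0 (t / N - 1) * (1 / N)) + 2 * max 0 (- (t / N) - 1) * (1 / N))" for t
  have "(cutoff N has_real_derivative D t) (at t)" for t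
    unfolding cutoff_def D_def using N
    by (auto intro!: derivative_eq_intros simp: algebra_simps)
  then have "((\<lambda>t. complex_of_real (cutoff N t)) has_vector_derivative complex_of_real (D t)) (at t)" for t
    by (intro has_vector_derivative_of_real) (simp add: has_real_derivative_iff_has_vector_derivative)
  moreover have "continuous_on UNIV (\<lambda>t. complex_of_real (D t))"
    unfolding D_def by (intro continuous_intros) (use N in auto)
  ultimately have 1: "(\<lambda>t. complex_of_real (cutoff N t)) C1_differentiable_on UNIV"
    unfolding C1_differentiable_on_def by (intro exI[of _ "\<lambda>t. complex_of_real (D t)"]) auto
  have 2: "cker z C1_differentiable_on UNIV"
    unfolding C1_differentiable_on_def
    by (intro exI[of _ "\<lambda>t. - (cker z t * cker z t)"] conjI ballI cker_deriv z continuous_intros cker_continuous)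
  show "(\<lambda>t. complex_of_real (cutoff N t) * cker z t) C1_differentiable_on UNIV"
    by (intro C1_differentiable_on_mult 1 2)
  have "{t. complex_of_real (cutoff N t) * cker z t \<noteq> 0} \<subseteq> {- (2 * N)..2 * N}"
  proof clarsimp
    fix t assume "cutoff N t \<noteq> 0"
    then have "\<not> \<bar>t\<bar> \<ge> 2 * N" using cutoff_eq_0 N by blast
    then show "- (2 * N) \<le> t \<and> t \<le> 2 * N" by linarith
  qed
  then show "compact (closure {t. complex_of_real (cutoff N t) * cker z t \<noteq> 0})"
    unfolding compact_closure by (rule bounded_subset[rotated]) simp
qed

text \<open>The modulus of \<open>t - z\<close> is at least \<open>\<bar>Im z\<bar>\<close>, so the
  constant \<open>1 + cmod z\<close> left over by the triangle inequality can be absorbed into a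
  multiple of that modulus.\<close>

lemma cker_decay:
  assumes "Im z \<noteq> 0"
  shows "cmod (cker z t) \<le> (1 + (1 + cmod z) / \<bar>Im z\<bar>) * (1 / (1 + \<bar>t\<bar>))"
proof -
  define d A where "d = cmod (complex_of_real t - z)" and "A = 1 + (1 + cmod z) / \<bar>Im z\<bar>"
  have d: "\<bar>Im z\<bar> \<le> d" using abs_Im_le_cmod[of "complex_of_real t - z"] by (simp add: d_def)
  then have pos: "d > 0" "\<bar>Im z\<bar> > 0" using assms by auto
  have "\<bar>t\<bar> \<le> d + cmod z"
    using norm_triangle_ineq[of "complex_of_real t - z" z] by (simp add: d_def)
  moreover have "(1 + cmod z) * 1 \<le> (1 + cmod z) * (d / \<bar>Im z\<bar>)"
    using d pos by (intro mult_left_mono) (auto simp: le_divide_eq)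
  ultimately have "1 + \<bar>t\<bar> \<le> A * d"
    by (simp add: A_def distrib_right)
  then have "1 / d \<le> A * (1 / (1 + \<bar>t\<bar>))"
    using pos by (simp add: divide_simps add_pos_nonneg)
  then show ?thesis
    by (simp add: cker_def norm_divide d_def A_def)
qed

lemma
  assumes sets: "sets M = sets borel" and int: "integrable M (\<lambda>t. 1 / (1 + \<bar>t\<bar>))" and z: "Im z \<noteq> 0"
  shows integrable_cker: "integrable M (cker z)" and L2_cker_base: "L2 M (cker z)"
proof -
  note [measurable_cong] = sets
  define K where "K = 1 + (1 + cmod z) / \<bar>Im z\<bar>"
  have K: "cmod (cker z t) \<le> K * (1 / (1 + \<bar>t\<bar>))" for t
    using cker_decay[OF z] by (simp add: K_def)
  have m: "cker z \<in> borel_measurable M" by measurable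
  show "integrable M (cker z)"
  proof (rule Bochner_Integration.integrable_bound[OF integrable_mult_right[OF int, of K] m])
    show "AE t in M. norm (cker z t) \<le> norm (K * (1 / (1 + \<bar>t\<bar>)))"
      using order_trans[OF K abs_ge_self] by simp
  qed
  show "L2 M (cker z)"
    unfolding L2_def
  proof
    show "integrable M (\<lambda>t. (cmod (cker z t))\<^sup>2)"
    proof (rule Bochner_Integration.integrable_bound[OF integrable_mult_right[OF int, of "K\<^sup>2"]])
      show "AE t in M. norm ((cmod (cker z t))\<^sup>2) \<le> norm (K\<^sup>2 * (1 / (1 + \<bar>t\<bar>)))"
      proof (rule AE_I2)
        fix t :: real
        have "(cmod (cker z t))\<^sup>2 \<le> (K * (1 / (1 + \<bar>t\<bar>)))\<^sup>2" by (intro power_mono K) simp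
        also have "\<dots> = K\<^sup>2 * (1 / (1 + \<bar>t\<bar>))\<^sup>2" by (rule power_mult_distrib)
        also have "\<dots> \<le> K\<^sup>2 * (1 / (1 + \<bar>t\<bar>))"
        proof (rule mult_left_mono)
          show "(1 / (1 + \<bar>t\<bar>))\<^sup>2 \<le> 1 / (1 + \<bar>t\<bar>)"
            using power_decreasing[of 1 2 "1 / (1 + \<bar>t\<bar>)"] by simp
        qed simp
        finally show "norm ((cmod (cker z t))\<^sup>2) \<le> norm (K\<^sup>2 * (1 / (1 + \<bar>t\<bar>)))" by simp
      qed
    qed (use m in measurable)
  qed (rule m)
qed

lemma dq_measurable:
  assumes "continuous_on UNIV f" "sets M = sets borel"
  shows "dq f s \<in> borel_measurable M"
proof -
  note [measurable_cong] = assms(2)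
  have [measurable]: "f \<in> borel_measurable borel" by (intro borel_measurable_continuous_onI assms(1))
  show ?thesis unfolding dq_def by measurable
qed

text \<open>Where the cut-off is 1 at both points, the difference quotient of
  \<open>1 / (t - z)\<close> is an exact product. The strict bound on \<open>s\<close> leaves a
  neighbourhood for the derivative on the diagonal.\<close>

lemma dq_cutoff_cker:
  assumes z: "Im z \<noteq> 0" and s: "\<bar>s\<bar> < N" and t: "\<bar>t\<bar> \<le> N"
  shows "dq (\<lambda>t. complex_of_real (cutoff N t) * cker z t) s t = - (cker z s * cker z t)"
proof (cases "t = s")
  case True
  have "((\<lambda>t. complex_of_real (cutoff N t) * cker z t) has_vector_derivative - (cker z s * cker z s)) (at s)"
  proof (rule has_vector_derivative_transform_within_open[OF cker_deriv[OF z]])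
    show "s \<in> {- N<..<N}" using s by auto
    show "cker z x = complex_of_real (cutoff N x) * cker z x" if "x \<in> {- N<..<N}" for x
    proof -
      have "\<bar>x\<bar> \<le> N" using that by auto
      then show ?thesis by (simp add: cutoff_eq_1)
    qed
  qed simp
  then show ?thesis using True by (simp add: dq_def vector_derivative_at)
next
  case False
  have 1: "complex_of_real (s - t) \<noteq> 0" using False by simp
  have "1 / a - 1 / b = - (1 / a * (1 / b)) * (a - b)" if "a \<noteq> 0" "b \<noteq> 0" for a b :: complex
    using that by (simp add: field_simps)
  from this[OF of_real_diff_nonzero[OF z, of s] of_real_diff_nonzero[OF z, of t]]
  have "cker z s - cker z t = - (cker z s * cker z t) * complex_of_real (s - t)"
    by (simp add: cker_def)
  then have "(cker z s - cker z t) / complex_of_real (s - t) = - (cker z s * cker z t)"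
    using 1 by (simp add: divide_eq_eq)
  then show ?thesis using False s t by (simp add: dq_def cutoff_eq_1)
qed

text \<open>At each \<open>t\<close> the difference quotients are eventually
  \<open>- (cker z s * cker z t)\<close>, whose integral is \<open>- F(z) * cker z s\<close>. The
  work lies in dominating them by a multiple of the integrable weight
  \<open>1 / (1 + \<bar>t\<bar>)\<close> uniformly in the cut-off radius.\<close>

lemma Vop_cutoff_cker_limit:
  assumes sets: "sets M = sets borel" and int: "integrable M (\<lambda>t. 1 / (1 + \<bar>t\<bar>))" and z: "Im z \<noteq> 0"
  shows "(\<lambda>n. Vop \<alpha> M (\<lambda>t. complex_of_real (cutoff (real (Suc n)) t) * cker z t) s)
    \<longlonglongrightarrow> (1 + of_real \<alpha> * Fcauchy M z) * cker z s"
proof -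
  define f where "f n t = complex_of_real (cutoff (real (Suc n)) t) * cker z t" for n t
  have fcont: "continuous_on UNIV (f n)" for n
    unfolding f_def cutoff_def by (intro continuous_intros cker_continuous z) auto
  obtain n0 :: nat where n0: "2 * \<bar>s\<bar> + 1 \<le> real n0" using real_arch_simple by blast
  define K where "K = 1 + (1 + cmod z) / \<bar>Im z\<bar>"
  define B where "B = K / \<bar>Im z\<bar> + 4 / \<bar>Im z\<bar>"
  have K0: "K \<ge> 0" by (simp add: K_def)
  have fz: "cmod (f n t) \<le> 1 / \<bar>Im z\<bar>" for n t
    using mult_mono[OF cutoff_range(2)[of "real (Suc n)" t] cker_bound[OF z, of t]] cutoff_range(1)[of "real (Suc n)" t]
    by (simp add: f_def norm_mult)
  have bound: "norm (dq (f n) s t) \<le> B * (1 / (1 + \<bar>t\<bar>))" if n: "n \<ge> n0" for n t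
  proof (cases "\<bar>t\<bar> \<le> real (Suc n)")
    case True
    then have "dq (f n) s t = - (cker z s * cker z t)"
      unfolding f_def using dq_cutoff_cker[OF z, of s "real (Suc n)" t] n0 n by simp
    then have "norm (dq (f n) s t) = cmod (cker z s) * cmod (cker z t)" by (simp add: norm_mult)
    also have "\<dots> \<le> (1 / \<bar>Im z\<bar>) * (K * (1 / (1 + \<bar>t\<bar>)))"
      using cker_decay[OF z, of t] by (intro mult_mono cker_bound z) (auto simp: K_def)
    also have "\<dots> = (K / \<bar>Im z\<bar>) * (1 / (1 + \<bar>t\<bar>))" by simp
    also have "\<dots> \<le> B * (1 / (1 + \<bar>t\<bar>))"
      by (rule mult_right_mono) (auto simp: B_def)
    finally show ?thesis .
  next
    case False
    have "real n0 \<le> real (Suc n)" using n by simp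
    with False n0 have "2 * \<bar>s\<bar> + 1 \<le> \<bar>t\<bar>" by linarith
    moreover have "\<bar>t\<bar> \<le> \<bar>s\<bar> + \<bar>s - t\<bar>" by linarith
    ultimately have le: "(1 + \<bar>t\<bar>) / 2 \<le> \<bar>s - t\<bar>" by argo
    then have ne: "t \<noteq> s" by auto
    have "norm (dq (f n) s t) = cmod (f n s - f n t) / \<bar>s - t\<bar>"
      using ne by (simp add: dq_def norm_divide del: of_real_diff)
    also have "\<dots> \<le> (2 / \<bar>Im z\<bar>) / ((1 + \<bar>t\<bar>) / 2)"
    proof (rule frac_le)
      show "cmod (f n s - f n t) \<le> 2 / \<bar>Im z\<bar>"
        using norm_triangle_ineq4[of "f n s" "f n t"] fz[of n s] fz[of n t] by simp
    qed (use le in auto)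
    also have "\<dots> = (4 / \<bar>Im z\<bar>) * (1 / (1 + \<bar>t\<bar>))" by simp
    also have "\<dots> \<le> B * (1 / (1 + \<bar>t\<bar>))"
      using K0 by (intro mult_right_mono) (auto simp: B_def)
    finally show ?thesis .
  qed
  \<comment> \<open>The domination is established from \<open>n0\<close> on; shifting the index
    makes it hold for every term, and \<open>LIMSEQ_offset\<close> undoes the shift.\<close>
  have "(\<lambda>n. \<integral>t. dq (f (n + n0)) s t \<partial>M) \<longlonglongrightarrow> (\<integral>t. - (cker z s * cker z t) \<partial>M)"
  proof (rule integral_dominated_convergence[where w = "\<lambda>t. B * (1 / (1 + \<bar>t\<bar>))"])
    show "AE t in M. (\<lambda>n. dq (f (n + n0)) s t) \<longlonglongrightarrow> - (cker z s * cker z t)"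
    proof (rule AE_I2)
      fix t :: real
      obtain K :: nat where K: "\<bar>t\<bar> \<le> real K" using real_arch_simple by blast
      have "\<forall>\<^sub>F n in sequentially. dq (f (n + n0)) s t = - (cker z s * cker z t)"
        using eventually_ge_at_top[of K]
      proof eventually_elim
        case (elim n)
        then show ?case
          unfolding f_def using dq_cutoff_cker[OF z, of s "real (Suc (n + n0))" t] n0 K by simp
      qed
      then show "(\<lambda>n. dq (f (n + n0)) s t) \<longlonglongrightarrow> - (cker z s * cker z t)" by (rule tendsto_eventually)
    qed
    show "(\<lambda>t. - (cker z s * cker z t)) \<in> borel_measurable M"
      using integrable_cker[OF sets int z] by auto
    show "dq (f (n + n0)) s \<in> borel_measurable M" for n
      by (rule dq_measurable[OF fcont sets])
    show "integrable M (\<lambda>t. B * (1 / (1 + \<bar>t\<bar>)))" by (rule integrable_mult_right[OF int])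
    show "AE t in M. norm (dq (f (n + n0)) s t) \<le> B * (1 / (1 + \<bar>t\<bar>))" for n
      using bound[of "n + n0"] by simp
  qed
  moreover have "(\<integral>t. - (cker z s * cker z t) \<partial>M) = - (cker z s * Fcauchy M z)"
  proof -
    have "Fcauchy M z = (\<integral>t. cker z t \<partial>M)" by (simp add: Fcauchy_def cker_def)
    then show ?thesis by simp
  qed
  ultimately have "(\<lambda>n. \<integral>t. dq (f (n + n0)) s t \<partial>M) \<longlonglongrightarrow> - (cker z s * Fcauchy M z)"
    by (simp only:)
  then have lim: "(\<lambda>n. \<integral>t. dq (f n) s t \<partial>M) \<longlonglongrightarrow> - (cker z s * Fcauchy M z)"
    by (rule LIMSEQ_offset)
  have "\<forall>\<^sub>F n in sequentially. f n s = cker z s"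
    using eventually_ge_at_top[of n0] by eventually_elim (use n0 in \<open>auto simp: f_def cutoff_eq_1\<close>)
  then have "(\<lambda>n. f n s) \<longlonglongrightarrow> cker z s" by (rule tendsto_eventually)
  from tendsto_diff[OF this tendsto_mult[OF tendsto_const lim]]
  have "(\<lambda>n. Vop \<alpha> M (f n) s) \<longlonglongrightarrow> cker z s - complex_of_real \<alpha> * - (cker z s * Fcauchy M z)"
    unfolding Vop_def .
  then show ?thesis unfolding f_def by (simp add: algebra_simps)
qed

text \<open>The truncated kernels converge in L2(\<mu>), so their images converge in L2(\<nu>) and,
  along a subsequence, almost everywhere. On these functions \<open>T\<close> agrees with
  \<open>Vop\<close>, whose pointwise limit is already known.\<close>

lemma extension_cker:
  assumes sets: "sets \<mu> = sets borel" and int: "integrable \<mu> (\<lambda>t. 1 / (1 + \<bar>t\<bar>))"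
    and T: "L2_op \<mu> \<nu> C T"
    and ext: "\<And>f. C1c f \<Longrightarrow> AE s in \<nu>. T f s = Vop \<alpha> \<mu> f s"
    and z: "Im z \<noteq> 0"
  shows "AE s in \<nu>. T (cker z) s = (1 + of_real \<alpha> * Fcauchy \<mu> z) * cker z s"
proof -
  define f where "f n t = complex_of_real (cutoff (real (Suc n)) t) * cker z t" for n t
  note [measurable_cong] = sets
  have b: "L2 \<mu> (cker z)" by (rule L2_cker_base[OF sets int z])
  have cm: "(\<lambda>t. complex_of_real (cutoff (real (Suc n)) t)) \<in> borel_measurable borel" for n
    unfolding cutoff_def by (intro borel_measurable_continuous_onI continuous_intros) auto
  then have cm' [measurable]: "(\<lambda>t. complex_of_real (cutoff (real (Suc n)) t)) \<in> borel_measurable \<mu>" for n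
    by measurable
  have f: "L2 \<mu> (f n)" for n
    unfolding f_def by (rule L2_mult[where C = 1, OF b cm']) (simp add: cutoff_range del: of_nat_Suc)
  have bm [measurable]: "cker z \<in> borel_measurable \<mu>" by measurable
  have "(\<lambda>n. \<integral>t. (cmod (f n t - cker z t))\<^sup>2 \<partial>\<mu>) \<longlonglongrightarrow> (\<integral>t. 0 \<partial>\<mu>)"
  proof (rule integral_dominated_convergence[where w = "\<lambda>t. (cmod (cker z t))\<^sup>2"])
    show "AE t in \<mu>. (\<lambda>n. (cmod (f n t - cker z t))\<^sup>2) \<longlonglongrightarrow> 0"
    proof (rule AE_I2)
      fix t :: real
      obtain K :: nat where K: "\<bar>t\<bar> \<le> real K" using real_arch_simple by blast
      have "\<forall>\<^sub>F n in sequentially. (cmod (f n t - cker z t))\<^sup>2 = 0"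
        using eventually_ge_at_top[of K] by eventually_elim (use K in \<open>auto simp: f_def cutoff_eq_1\<close>)
      then show "(\<lambda>n. (cmod (f n t - cker z t))\<^sup>2) \<longlonglongrightarrow> 0" by (rule tendsto_eventually)
    qed
    show "AE t in \<mu>. norm ((cmod (f n t - cker z t))\<^sup>2) \<le> (cmod (cker z t))\<^sup>2" for n
    proof (rule AE_I2)
      fix t :: real
      define x where "x = cutoff (real (Suc n)) t - 1"
      have x: "\<bar>x\<bar> \<le> 1" using cutoff_range[of "real (Suc n)" t] by (simp add: x_def abs_le_iff)
      have "f n t - cker z t = complex_of_real x * cker z t"
        by (simp add: f_def x_def algebra_simps)
      then have "cmod (f n t - cker z t) = \<bar>x\<bar> * cmod (cker z t)" by (simp add: norm_mult)
      also have "\<dots> \<le> cmod (cker z t)" using mult_right_mono[OF x, of "cmod (cker z t)"] by simp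
      finally show "norm ((cmod (f n t - cker z t))\<^sup>2) \<le> (cmod (cker z t))\<^sup>2"
        by (simp add: power_mono)
    qed
    show "(\<lambda>t. (cmod (f n t - cker z t))\<^sup>2) \<in> borel_measurable \<mu>" for n
      by (rule borel_measurable_integrable[OF L2_integrable[OF L2_diff[OF f b]]])
  qed (use L2_integrable[OF b] in auto)
  then have "(\<lambda>n. sqrt (\<integral>t. (cmod (f n t - cker z t))\<^sup>2 \<partial>\<mu>)) \<longlonglongrightarrow> sqrt 0"
    by (intro tendsto_real_sqrt) simp
  then have conv: "(\<lambda>n. L2norm \<mu> (\<lambda>t. f n t - cker z t)) \<longlonglongrightarrow> 0"
    by (simp add: L2norm_def)
  have "(\<lambda>n. L2norm \<nu> (\<lambda>s. T (f n) s - T (cker z) s)) \<longlonglongrightarrow> 0"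
  proof (rule Lim_null_comparison)
    show "\<forall>\<^sub>F n in sequentially. norm (L2norm \<nu> (\<lambda>s. T (f n) s - T (cker z) s)) \<le> C * L2norm \<mu> (\<lambda>t. f n t - cker z t)"
    proof (rule always_eventually, rule allI)
      fix n
      have lin: "AE s in \<nu>. T (\<lambda>t. f n t - cker z t) s = T (f n) s - T (cker z) s"
        by (rule L2_op_diff[OF T f b])
      have "L2norm \<nu> (\<lambda>s. T (f n) s - T (cker z) s) = L2norm \<nu> (T (\<lambda>t. f n t - cker z t))"
      proof (rule L2norm_cong_AE)
        show "AE s in \<nu>. T (f n) s - T (cker z) s = T (\<lambda>t. f n t - cker z t) s"
          using lin by eventually_elim simp
      qed (rule L2_measurable[OF L2_diff[OF L2_op_L2[OF T f] L2_op_L2[OF T b]]]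
          L2_measurable[OF L2_op_L2[OF T L2_diff[OF f b]]])+
      also have "\<dots> \<le> C * L2norm \<mu> (\<lambda>t. f n t - cker z t)" by (rule L2_op_bdd[OF T L2_diff[OF f b]])
      finally show "norm (L2norm \<nu> (\<lambda>s. T (f n) s - T (cker z) s)) \<le> C * L2norm \<mu> (\<lambda>t. f n t - cker z t)" by simp
    qed
    show "(\<lambda>n. C * L2norm \<mu> (\<lambda>t. f n t - cker z t)) \<longlonglongrightarrow> 0"
      using tendsto_mult[OF tendsto_const conv, of C] by simp
  qed
  from L2_tendsto_AE_subseq[OF L2_op_L2[OF T f] L2_op_L2[OF T b] this]
  obtain r :: "nat \<Rightarrow> nat" where r: "strict_mono r" "AE s in \<nu>. (\<lambda>n. T (f (r n)) s) \<longlonglongrightarrow> T (cker z) s"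
    by blast
  have "AE s in \<nu>. \<forall>n. T (f n) s = Vop \<alpha> \<mu> (f n) s"
    unfolding AE_all_countable f_def by (intro allI ext C1c_cutoff_cker z) simp
  with r(2) show ?thesis
  proof eventually_elim
    case (elim s)
    then have "(\<lambda>n. Vop \<alpha> \<mu> (f (r n)) s) \<longlonglongrightarrow> T (cker z) s" by simp
    moreover have "(\<lambda>n. Vop \<alpha> \<mu> (f (r n)) s) \<longlonglongrightarrow> (1 + of_real \<alpha> * Fcauchy \<mu> z) * cker z s"
      using LIMSEQ_subseq_LIMSEQ[OF Vop_cutoff_cker_limit[OF sets int z, folded f_def] r(1)]
      by (simp add: o_def)
    ultimately show ?case by (rule LIMSEQ_unique)
  qed
qed

section \<open>Resolvents and the multiplication operator\<close>

lemma ip_mult_cker: "ip M (\<lambda>s. cker z s * f s) g = ip M f (\<lambda>s. cker (cnj z) s * g s)"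
  unfolding ip_def by (simp add: cker_cnj mult_ac)

lemma L2_cker_mult:
  assumes "sets M = sets borel" "L2 M f" "Im z \<noteq> 0"
  shows "L2 M (\<lambda>t. cker z t * f t)"
proof (rule L2_mult[OF assms(2)])
  show "cker z \<in> borel_measurable M"
    using assms(1) cker_measurable measurable_cong_sets by blast
  show "AE t in M. cmod (cker z t) \<le> 1 / \<bar>Im z\<bar>" using cker_bound[OF assms(3)] by simp
qed

lemma Fcauchy_cker: "Fcauchy M z = (\<integral>t. cker z t \<partial>M)"
  by (simp add: Fcauchy_def cker_def)

lemma Fcauchy_cnj: "Fcauchy M (cnj z) = cnj (Fcauchy M z)"
  unfolding Fcauchy_cker by (simp add: cker_cnj flip: Bochner_Integration.integral_cnj)

lemma resolv_A_cker:
  "resolv_A \<alpha> M z f = (\<lambda>t. cker z t * f t + (- (of_real \<alpha> * ip M f (cker (cnj z)) / (1 + of_real \<alpha> * Fcauchy M z))) * cker z t)"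
  unfolding resolv_A_def ip_def by (rule ext) (simp add: cker_cnj, simp add: cker_def)

text \<open>Im F(z) is Im z times the squared L2 norm of \<open>cker z\<close>. As \<alpha> is real
  and non-zero, a zero of the denominator would make the nowhere vanishing kernel zero almost
  everywhere, against the non-triviality of \<open>M\<close>.\<close>

lemma one_plus_Fcauchy_nonzero:
  assumes sets: "sets M = sets borel" and int: "integrable M (\<lambda>t. 1 / (1 + \<bar>t\<bar>))"
    and nz: "emeasure M UNIV \<noteq> 0" and \<alpha>: "\<alpha> \<noteq> 0" and z: "Im z \<noteq> 0"
  shows "1 + complex_of_real \<alpha> * Fcauchy M z \<noteq> 0"
proof
  assume h: "1 + complex_of_real \<alpha> * Fcauchy M z = 0"
  have b: "L2 M (cker z)" by (rule L2_cker_base[OF sets int z])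
  have "Im (cker z t) = Im z * (cmod (cker z t))\<^sup>2" for t
  proof -
    have "cmod (complex_of_real t - z) \<noteq> 0" using of_real_diff_nonzero[OF z, of t] by simp
    then show ?thesis
      unfolding cker_def by (simp add: Im_divide norm_divide power_divide cmod_power2)
  qed
  then have "(\<integral>t. Im (cker z t) \<partial>M) = Im z * (L2norm M (cker z))\<^sup>2"
    by (simp add: L2norm_power2)
  then have "Im (Fcauchy M z) = Im z * (L2norm M (cker z))\<^sup>2"
    unfolding Fcauchy_cker using integral_Im[OF integrable_cker[OF sets int z]] by simp
  moreover have "Im (1 + complex_of_real \<alpha> * Fcauchy M z) = 0" unfolding h by simp
  ultimately have "L2norm M (cker z) = 0" using \<alpha> z by simp
  from L2norm_eq_0[OF b this] have "AE t in M. False"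
    using cker_nonzero[OF z] by simp
  then have "emeasure M (space M) = 0" by (simp add: AE_iff_null null_setsD1)
  then show False using nz sets_eq_imp_space_eq[OF sets] by simp
qed

context
  fixes M :: "real measure" and \<alpha> :: real
  assumes sets: "sets M = sets borel" and int: "integrable M (\<lambda>t. 1 / (1 + \<bar>t\<bar>))"
    and nz: "emeasure M UNIV \<noteq> 0" and \<alpha>: "\<alpha> \<noteq> 0"
begin

lemma L2_resolv_A:
  assumes z: "Im z \<noteq> 0" and f: "L2 M f"
  shows "L2 M (resolv_A \<alpha> M z f)"
  unfolding resolv_A_cker
  by (rule L2_add[OF L2_cker_mult[OF sets f z] L2_scale[OF L2_cker_base[OF sets int z]]])

lemma ip_resolv_A_left:
  assumes z: "Im z \<noteq> 0" and f: "L2 M f" and g: "L2 M g"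
  shows "ip M (resolv_A \<alpha> M z f) g = ip M (\<lambda>t. cker z t * f t) g
    - of_real \<alpha> * ip M f (cker (cnj z)) * ip M (cker z) g / (1 + of_real \<alpha> * Fcauchy M z)"
  unfolding resolv_A_cker
  by (subst ip_add_left[OF L2_cker_mult[OF sets f z] L2_scale[OF L2_cker_base[OF sets int z]] g])
     (simp only: ip_scale_left, simp)

text \<open>Self-adjointness of the perturbed operator in resolvent form: the rank one corrections
  at \<open>z\<close> and \<open>cnj z\<close> are adjoint to each other because \<alpha> is real
  and F commutes with conjugation.\<close>

lemma ip_resolv_A:
  assumes z: "Im z \<noteq> 0" and f: "L2 M f" and g: "L2 M g"
  shows "ip M (resolv_A \<alpha> M z f) g = ip M f (resolv_A \<alpha> M (cnj z) g)"
proof -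
  have z': "Im (cnj z) \<noteq> 0" using z by simp
  have "ip M f (resolv_A \<alpha> M (cnj z) g) = cnj (ip M (resolv_A \<alpha> M (cnj z) g) f)"
    by (rule ip_cnj[symmetric])
  also have "\<dots> = ip M f (\<lambda>t. cker (cnj z) t * g t)
    - of_real \<alpha> * ip M (cker z) g * ip M f (cker (cnj z)) / (1 + of_real \<alpha> * Fcauchy M z)"
    unfolding ip_resolv_A_left[OF z' g f] by (simp add: ip_cnj Fcauchy_cnj)
  finally show ?thesis
    unfolding ip_resolv_A_left[OF z f g] by (simp only: ip_mult_cker) (simp add: mult_ac)
qed

text \<open>The resolvent keeps the span of the two kernels invariant. With
  \<open>P v = 1 + \<alpha> F(v)\<close>, the inner product in the rank one term is a divided
  difference, and \<alpha> times it is \<open>(P z - P w) / (z - w)\<close>.\<close>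

lemma resolv_A_of_cker:
  assumes z: "Im z \<noteq> 0" and w: "Im w \<noteq> 0" and zw: "z \<noteq> w"
  shows "resolv_A \<alpha> M z (cker w) = (\<lambda>t.
    ((1 + of_real \<alpha> * Fcauchy M w) / ((1 + of_real \<alpha> * Fcauchy M z) * (z - w))) * cker z t
    + (- 1 / (z - w)) * cker w t)"
proof -
  define P where "P v = 1 + complex_of_real \<alpha> * Fcauchy M v" for v
  have P: "P z \<noteq> 0"
    unfolding P_def by (rule one_plus_Fcauchy_nonzero[OF sets int nz \<alpha> z])
  have "ip M (cker w) (cker (cnj z)) = (\<integral>t. (cker z t - cker w t) / (z - w) \<partial>M)"
    unfolding ip_def by (simp add: cker_cnj cker_mult[OF z w zw, symmetric] mult.commute)
  also have "\<dots> = (Fcauchy M z - Fcauchy M w) / (z - w)"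
    unfolding Fcauchy_cker using integrable_cker[OF sets int z] integrable_cker[OF sets int w] by simp
  finally have "ip M (cker w) (cker (cnj z)) = (Fcauchy M z - Fcauchy M w) / (z - w)" .
  then have "of_real \<alpha> * ip M (cker w) (cker (cnj z)) = (P z - P w) / (z - w)"
    by (simp only:) (simp add: P_def algebra_simps diff_divide_distrib)
  moreover have "(a - b) / d + (- ((p - q) / d / p)) * a = q / (p * d) * a + (- 1 / d) * b"
    if "d \<noteq> 0" "p \<noteq> 0" for a b d p q :: complex
    using that by (simp add: field_simps)
  ultimately show ?thesis
    unfolding resolv_A_cker P_def[symmetric] cker_mult[OF z w zw] using P zw by simp
qed

text \<open>Both sides are tested against the Cauchy kernels \<open>cker w\<close>, on which T is explicit; this only
  determines an L2 function because the Cauchy transform is injective.\<close>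
lemma resolvent_intertwining:
  assumes setsN: "sets N = sets borel" and T: "L2_op M N C T"
    and Tc: "\<And>z. Im z \<noteq> 0 \<Longrightarrow> AE s in N. T (cker z) s = (1 + of_real \<alpha> * Fcauchy M z) * cker z s"
    and z: "Im z \<noteq> 0" and f: "L2 M f"
  shows "AE s in N. T (resolv_A \<alpha> M z f) s = cker z s * T f s"
proof -
  note b = L2_cker_base[OF sets int]
  have z': "Im (cnj z) \<noteq> 0" using z by simp
  have bi: "Im \<i> \<noteq> 0" by simp
  obtain T' where T': "L2_adj M N T T'"
    using L2_adj_exists[OF b[OF bi] cker_nonzero[OF bi] T] by blast
  define P where "P v = 1 + complex_of_real \<alpha> * Fcauchy M v" for v
  have P: "P v \<noteq> 0" if "Im v \<noteq> 0" for v
    unfolding P_def by (rule one_plus_Fcauchy_nonzero[OF sets int nz \<alpha> that])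
  have on_cker: "AE s in N. T (resolv_A \<alpha> M z (cker w)) s = cker z s * T (cker w) s"
    if w: "Im w \<noteq> 0" "z \<noteq> w" for w
  proof -
    define x y where "x = P w / (P z * (z - w))" and "y = - 1 / (z - w)"
    have "AE s in N. T (\<lambda>t. x * cker z t + y * cker w t) s = T (\<lambda>t. x * cker z t) s + T (\<lambda>t. y * cker w t) s"
      by (rule L2_op_add[OF T L2_scale[OF b[OF z]] L2_scale[OF b[OF w(1)]]])
    with L2_op_scale[OF T b[OF z], of x] L2_op_scale[OF T b[OF w(1)], of y] Tc[OF z] Tc[OF w(1)]
    show ?thesis
      unfolding resolv_A_of_cker[OF z w] P_def[symmetric] x_def[symmetric] y_def[symmetric]
    proof eventually_elim
      case (elim s)
      have "T (\<lambda>t. x * cker z t + y * cker w t) s = x * (P z * cker z s) + y * (P w * cker w s)"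
        using elim by simp
      \<comment> \<open>The denominator \<open>P z\<close> of \<open>x\<close> cancels the factor
        that \<open>T\<close> puts on \<open>cker z\<close>, so both terms carry the common factor
        \<open>P w\<close>.\<close>
      also have "\<dots> = P w * ((cker z s - cker w s) / (z - w))"
        using P[OF z] w(2) by (simp add: x_def y_def divide_simps) (simp add: algebra_simps)
      finally show ?case using elim cker_mult[OF z w, of s] by (simp add: mult_ac)
    qed
  qed
  \<comment> \<open>The transposed identity compares two elements of L2(M), and these can be tested
    against the kernels \<open>cker w\<close>, on which \<open>on_cker\<close> is available.\<close>
  have adj: "AE t in M. resolv_A \<alpha> M (cnj z) (T' g) t = T' (\<lambda>s. cker (cnj z) s * g s) t"
    if g: "L2 N g" for g
  proof -
    define k1 k2 where "k1 = resolv_A \<alpha> M (cnj z) (T' g)" and "k2 = T' (\<lambda>s. cker (cnj z) s * g s)"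
    have g2: "L2 N (\<lambda>s. cker (cnj z) s * g s)" by (rule L2_cker_mult[OF setsN g z'])
    have k: "L2 M k1" "L2 M k2"
      unfolding k1_def k2_def by (rule L2_resolv_A[OF z' L2_adj_L2[OF T' g]], rule L2_adj_L2[OF T' g2])
    have "AE t in M. cnj (k1 t - k2 t) = 0"
    proof (rule L2_Cauchy_transform_unique[OF sets b[OF bi] L2_cnj[OF L2_diff[OF k]]])
      \<comment> \<open>This width of the strip excludes \<open>w = z\<close>, where the resolvent
        identity breaks down.\<close>
      show "0 < \<bar>Im z\<bar>" using z by simp
      fix w assume w: "Im w \<noteq> 0" "\<bar>Im w\<bar> < \<bar>Im z\<bar>"
      then have zw: "z \<noteq> w" by auto
      have r: "L2 M (resolv_A \<alpha> M z (cker w))" by (rule L2_resolv_A[OF z b[OF w(1)]])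
      have "ip M (cker w) k1 = ip M (resolv_A \<alpha> M z (cker w)) (T' g)"
        unfolding k1_def by (rule ip_resolv_A[OF z b[OF w(1)] L2_adj_L2[OF T' g], symmetric])
      also have "\<dots> = ip N (T (resolv_A \<alpha> M z (cker w))) g"
        by (rule L2_adj_ip[OF T' g r, symmetric])
      also have "\<dots> = ip N (\<lambda>s. cker z s * T (cker w) s) g"
        by (rule ip_cong_AE[OF L2_measurable[OF L2_op_L2[OF T r]]
              L2_measurable[OF L2_cker_mult[OF setsN L2_op_L2[OF T b[OF w(1)]] z]]
              L2_measurable[OF g] L2_measurable[OF g] on_cker[OF w(1) zw]]) simp
      also have "\<dots> = ip M (cker w) k2"
        unfolding k2_def ip_mult_cker by (rule L2_adj_ip[OF T' g2 b[OF w(1)]])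
      finally have "ip M (cker w) (\<lambda>t. k1 t - k2 t) = 0"
        by (simp add: ip_diff_right[OF k b[OF w(1)]])
      then show "(\<integral>t. cnj (k1 t - k2 t) * cker w t \<partial>M) = 0"
        by (simp add: ip_def mult.commute)
    qed
    then show ?thesis by (simp add: k1_def k2_def)
  qed
  \<comment> \<open>The adjoint identity gives equal inner products of \<open>u\<close> and
    \<open>v\<close> with every vector; choosing \<open>g = u - v\<close> makes its norm
    vanish.\<close>
  define u v g where "u = T (resolv_A \<alpha> M z f)" and "v = (\<lambda>s. cker z s * T f s)" and "g = (\<lambda>s. u s - v s)"
  have r: "L2 M (resolv_A \<alpha> M z f)" by (rule L2_resolv_A[OF z f])
  have uv: "L2 N u" "L2 N v"
    unfolding u_def v_def by (rule L2_op_L2[OF T r], rule L2_cker_mult[OF setsN L2_op_L2[OF T f] z])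
  have g: "L2 N g" unfolding g_def by (rule L2_diff[OF uv])
  have g2: "L2 N (\<lambda>s. cker (cnj z) s * g s)" by (rule L2_cker_mult[OF setsN g z'])
  have "ip N u g = ip M (resolv_A \<alpha> M z f) (T' g)"
    unfolding u_def by (rule L2_adj_ip[OF T' g r])
  also have "\<dots> = ip M f (resolv_A \<alpha> M (cnj z) (T' g))"
    by (rule ip_resolv_A[OF z f L2_adj_L2[OF T' g]])
  also have "\<dots> = ip M f (T' (\<lambda>s. cker (cnj z) s * g s))"
    by (rule ip_cong_AE[OF L2_measurable[OF f] L2_measurable[OF f]
          L2_measurable[OF L2_resolv_A[OF z' L2_adj_L2[OF T' g]]] L2_measurable[OF L2_adj_L2[OF T' g2]] _ adj[OF g]]) simp
  also have "\<dots> = ip N v g"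
    unfolding v_def ip_mult_cker by (rule L2_adj_ip[OF T' g2 f, symmetric])
  finally have "ip N g u = ip N g v" by (metis ip_cnj)
  then have "ip N g g = 0"
    using ip_diff_right[OF uv g] by (simp add: g_def)
  then have "L2norm N g = 0" by (simp add: ip_self)
  from L2norm_eq_0[OF g this] show ?thesis by (simp add: g_def u_def v_def)
qed

text \<open>\<open>T T'\<close> commutes with multiplication by all Cauchy kernels, so \<open>(T T' g) (cnj g')\<close> and
  \<open>g (cnj (T T' g'))\<close> have the same Cauchy transform.\<close>
lemma op_adj_multiplication:
  assumes setsN: "sets N = sets borel" and baseN: "L2 N (cker \<i>)"
    and T: "L2_op M N C T" and T': "L2_adj M N T T'"
    and inter: "\<And>z f. Im z \<noteq> 0 \<Longrightarrow> L2 M f \<Longrightarrow> AE s in N. T (resolv_A \<alpha> M z f) s = cker z s * T f s"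
  obtains \<psi> :: "real \<Rightarrow> real" where "\<psi> \<in> borel_measurable N"
    "\<And>g. L2 N g \<Longrightarrow> AE s in N. T (T' g) s = complex_of_real (\<psi> s) * g s"
proof -
  have sf: "sigma_finite_measure N"
    by (rule sigma_finite_measure_if_pos_integrable[OF L2_integrable[OF baseN]]) (simp add: cker_nonzero)
  define S where "S g = T (T' g)" for g
  have S: "L2 N (S g)" if "L2 N g" for g
    unfolding S_def by (rule L2_op_L2[OF T L2_adj_L2[OF T' that]])
  have inner: "ip N (\<lambda>s. cker z s * S g s) g' = ip M (resolv_A \<alpha> M z (T' g)) (T' g')"
    if z: "Im z \<noteq> 0" and g: "L2 N g" and g': "L2 N g'" for z g g'
  proof -
    have k: "L2 M (T' g)" by (rule L2_adj_L2[OF T' g])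
    have r: "L2 M (resolv_A \<alpha> M z (T' g))" by (rule L2_resolv_A[OF z k])
    have "ip N (\<lambda>s. cker z s * S g s) g' = ip N (T (resolv_A \<alpha> M z (T' g))) g'"
    proof (rule ip_cong_AE[OF L2_measurable[OF L2_cker_mult[OF setsN S[OF g] z]]
          L2_measurable[OF L2_op_L2[OF T r]] L2_measurable[OF g'] L2_measurable[OF g']])
      show "AE s in N. cker z s * S g s = T (resolv_A \<alpha> M z (T' g)) s"
        using inter[OF z k] by eventually_elim (simp add: S_def)
    qed simp
    also have "\<dots> = ip M (resolv_A \<alpha> M z (T' g)) (T' g')" by (rule L2_adj_ip[OF T' g' r])
    finally show ?thesis .
  qed
  have sym: "AE s in N. S g s * cnj (g' s) = g s * cnj (S g' s)" if g: "L2 N g" and g': "L2 N g'" for g g'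
  proof -
    have i1: "integrable N (\<lambda>s. S g s * cnj (g' s))" by (rule ip_integrable[OF S[OF g] g'])
    have i2: "integrable N (\<lambda>s. g s * cnj (S g' s))" by (rule ip_integrable[OF g S[OF g']])
    have "AE s in N. S g s * cnj (g' s) - g s * cnj (S g' s) = 0"
    proof (rule Cauchy_transform_unique[OF sf setsN Bochner_Integration.integrable_diff[OF i1 i2]])
      show "(0::real) < 1" by simp
      fix z assume z: "Im z \<noteq> 0"
      have z': "Im (cnj z) \<noteq> 0" using z by simp
      have "ip N (\<lambda>s. cker z s * S g s) g' = ip M (T' g) (resolv_A \<alpha> M (cnj z) (T' g'))"
        unfolding inner[OF z g g'] by (rule ip_resolv_A[OF z L2_adj_L2[OF T' g] L2_adj_L2[OF T' g']])
      also have "\<dots> = cnj (ip N (\<lambda>s. cker (cnj z) s * S g' s) g)"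
        unfolding inner[OF z' g' g] by (rule ip_cnj[symmetric])
      also have "\<dots> = ip N g (\<lambda>s. cker (cnj z) s * S g' s)" by (rule ip_cnj)
      finally have eq: "ip N (\<lambda>s. cker z s * S g s) g' = ip N g (\<lambda>s. cker (cnj z) s * S g' s)" .
      have "integrable N (\<lambda>s. cker z s * S g s * cnj (g' s))"
        by (rule ip_integrable[OF L2_cker_mult[OF setsN S[OF g] z] g'])
      moreover have "integrable N (\<lambda>s. g s * cnj (cker (cnj z) s * S g' s))"
        by (rule ip_integrable[OF g L2_cker_mult[OF setsN S[OF g'] z']])
      ultimately have "(\<integral>s. cker z s * S g s * cnj (g' s) - g s * cnj (cker (cnj z) s * S g' s) \<partial>N) = 0"
        using eq by (simp add: ip_def)
      moreover have "(S g s * cnj (g' s) - g s * cnj (S g' s)) * cker z s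
          = cker z s * S g s * cnj (g' s) - g s * cnj (cker (cnj z) s * S g' s)" for s
        by (simp add: cker_cnj algebra_simps)
      ultimately show "(\<integral>s. (S g s * cnj (g' s) - g s * cnj (S g' s)) * cker z s \<partial>N) = 0"
        by simp
    qed
    then show ?thesis by simp
  qed
  \<comment> \<open>A nowhere vanishing reference vector: \<open>sym\<close> with
    \<open>g' = b\<close> expresses \<open>S g\<close> as \<open>g\<close> times the conjugate of
    \<open>S b / b\<close>, and with \<open>g = g' = b\<close> shows this quotient to be
    real.\<close>
  define b where "b = cker \<i>"
  have b: "b s \<noteq> 0" for s by (simp add: b_def cker_nonzero)
  have bL2: "L2 N b" using baseN by (simp add: b_def)
  define \<psi> where "\<psi> s = Re (S b s / b s)" for s
  note [measurable] = L2_measurable[OF S[OF bL2]] L2_measurable[OF bL2]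
  have "\<psi> \<in> borel_measurable N" unfolding \<psi>_def by measurable
  moreover have "AE s in N. T (T' g) s = complex_of_real (\<psi> s) * g s" if g: "L2 N g" for g
    using sym[OF g bL2] sym[OF bL2 bL2]
  proof eventually_elim
    case (elim s)
    have "S b s / b s = cnj (S b s / b s)" using elim(2) b[of s] by (simp add: field_simps)
    then have real: "S b s / b s = complex_of_real (\<psi> s)"
      unfolding \<psi>_def by (metis Reals_cnj_iff of_real_Re)
    have "S g s = g s * cnj (S b s / b s)" using elim(1) b[of s] by (simp add: field_simps)
    then show ?case unfolding real by (simp add: S_def mult.commute)
  qed
  ultimately show thesis by (rule that)
qed

end

text \<open>The quadratic form of \<open>T T'\<close> is the squared norm of \<open>T'\<close>; in
  this shape, order properties of \<psi> follow from norm estimates on test vectors.\<close>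

lemma adj_norm_multiplication:
  assumes T: "L2_op M N C T" and T': "L2_adj M N T T'" and \<psi>: "\<psi> \<in> borel_measurable N"
    and mult: "\<And>g. L2 N g \<Longrightarrow> AE s in N. T (T' g) s = complex_of_real (\<psi> s) * g s"
    and g: "L2 N g"
  shows "(L2norm M (T' g))\<^sup>2 = (\<integral>s. \<psi> s * (cmod (g s))\<^sup>2 \<partial>N)"
    and "integrable N (\<lambda>s. \<psi> s * (cmod (g s))\<^sup>2)"
proof -
  note [measurable] = \<psi> L2_measurable[OF g] L2_measurable[OF L2_op_L2[OF T L2_adj_L2[OF T' g]]]
  have AEeq: "AE s in N. T (T' g) s * cnj (g s) = complex_of_real (\<psi> s * (cmod (g s))\<^sup>2)"
    using mult[OF g] by eventually_elim (simp add: complex_norm_square mult.assoc del: of_real_power)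
  have "complex_of_real ((L2norm M (T' g))\<^sup>2) = ip N (T (T' g)) g"
    by (rule L2_adj_norm[OF T' g])
  also have "\<dots> = (\<integral>s. complex_of_real (\<psi> s * (cmod (g s))\<^sup>2) \<partial>N)"
    unfolding ip_def by (rule integral_cong_AE[OF _ _ AEeq]) measurable
  also have "\<dots> = complex_of_real (\<integral>s. \<psi> s * (cmod (g s))\<^sup>2 \<partial>N)" by (rule integral_complex_of_real)
  finally show "(L2norm M (T' g))\<^sup>2 = (\<integral>s. \<psi> s * (cmod (g s))\<^sup>2 \<partial>N)" by (simp only: of_real_eq_iff)
  have "integrable N (\<lambda>s. T (T' g) s * cnj (g s))"
    by (rule ip_integrable[OF L2_op_L2[OF T L2_adj_L2[OF T' g]] g])
  then have "integrable N (\<lambda>s. complex_of_real (\<psi> s * (cmod (g s))\<^sup>2))"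
    by (rule integrable_cong_AE_imp) (use AEeq in \<open>auto simp del: of_real_mult of_real_power\<close>)
  then show "integrable N (\<lambda>s. \<psi> s * (cmod (g s))\<^sup>2)" by (simp only: complex_of_real_integrable_eq)
qed

section \<open>Normalisation\<close>

context
  fixes M N :: "real measure" and C :: real and T T' and \<psi> :: "real \<Rightarrow> real"
  assumes setsM: "sets M = sets borel" and intM: "integrable M (\<lambda>t. 1 / (1 + \<bar>t\<bar>))"
    and setsN: "sets N = sets borel" and baseN: "L2 N (cker \<i>)"
    and T: "L2_op M N C T" and T': "L2_adj M N T T'" and C: "C \<ge> 0"
    and \<psi> [measurable]: "\<psi> \<in> borel_measurable N"
    and mult: "\<And>g. L2 N g \<Longrightarrow> AE s in N. T (T' g) s = complex_of_real (\<psi> s) * g s"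
begin

text \<open>The indicator alone may have infinite norm; the factor \<open>cker \<i>\<close> makes it
  square integrable while vanishing nowhere on \<open>E\<close>.\<close>

lemma L2_indicator_base:
  assumes "E \<in> sets borel"
  shows "L2 N (\<lambda>s. indicator E s * cker \<i> s)"
  by (rule L2_mult[where C = 1, OF baseN]) (use assms setsN in \<open>auto simp: indicator_def\<close>)

text \<open>On the set where \<psi> is at most 0 the norm formula forces \<open>T' g = 0\<close>, so
  \<open>g\<close> is orthogonal to the range of \<open>T\<close>. The range contains a non-zero
  multiple of every kernel, hence \<open>g\<close> vanishes by injectivity of the Cauchy transform.
  A single set settles both the sign and the zeros of \<psi>.\<close>

lemma multiplier_pos:
  assumes Tc: "\<And>z. Im z \<noteq> 0 \<Longrightarrow> AE s in N. T (cker z) s = c z * cker z s"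
    and c: "\<And>z. Im z \<noteq> 0 \<Longrightarrow> c z \<noteq> 0"
  shows "AE s in N. \<psi> s > 0"
proof -
  define E where "E = {s. \<psi> s \<le> 0}"
  define g :: "real \<Rightarrow> complex" where "g s = indicator E s * cker \<i> s" for s
  have "E = {s \<in> space N. \<psi> s \<le> 0}" using sets_eq_imp_space_eq[OF setsN] by (simp add: E_def)
  then have "E \<in> sets N" by simp
  then have E: "E \<in> sets borel" using setsN by simp
  have g: "L2 N g" unfolding g_def by (rule L2_indicator_base[OF E])
  have "(L2norm M (T' g))\<^sup>2 = (\<integral>s. \<psi> s * (cmod (g s))\<^sup>2 \<partial>N)"
    by (rule adj_norm_multiplication[OF T T' \<psi> mult g])
  also have "\<dots> \<le> (\<integral>s. 0 \<partial>N)"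
  proof (rule integral_mono)
    show "integrable N (\<lambda>s. \<psi> s * (cmod (g s))\<^sup>2)"
      by (rule adj_norm_multiplication[OF T T' \<psi> mult g])
    show "\<psi> s * (cmod (g s))\<^sup>2 \<le> 0" for s
      by (cases "s \<in> E") (auto simp: g_def E_def mult_nonpos_nonneg)
  qed simp
  finally have "L2norm M (T' g) = 0" by simp
  then have zero: "AE t in M. T' g t = 0" by (rule L2norm_eq_0[OF L2_adj_L2[OF T' g]])
  have "AE s in N. cnj (g s) = 0"
  proof (rule L2_Cauchy_transform_unique[OF setsN baseN L2_cnj[OF g]])
    show "(0::real) < 1" by simp
    fix z assume z: "Im z \<noteq> 0"
    have k: "L2 M (cker z)" by (rule L2_cker_base[OF setsM intM z])
    have "c z * ip N (cker z) g = ip N (\<lambda>s. c z * cker z s) g" by (simp add: ip_scale_left)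
    also have "\<dots> = ip N (T (cker z)) g"
    proof (rule ip_cong_AE[OF L2_measurable[OF L2_scale[OF L2_cker[OF setsN baseN z]]]
          L2_measurable[OF L2_op_L2[OF T k]] L2_measurable[OF g] L2_measurable[OF g]])
      show "AE s in N. c z * cker z s = T (cker z) s" using Tc[OF z] by eventually_elim simp
    qed simp
    also have "\<dots> = ip M (cker z) (T' g)" by (rule L2_adj_ip[OF T' g k])
    also have "\<dots> = ip M (cker z) (\<lambda>t. 0)"
      by (rule ip_cong_AE[OF L2_measurable[OF k] L2_measurable[OF k] L2_measurable[OF L2_adj_L2[OF T' g]] _ _ zero]) simp_all
    also have "\<dots> = 0" by (simp add: ip_def)
    finally show "(\<integral>s. cnj (g s) * cker z s \<partial>N) = 0"
      using c[OF z] by (simp add: ip_def mult.commute)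
  qed
  then show ?thesis
  proof eventually_elim
    case (elim s)
    then have "s \<notin> E" using cker_nonzero[of \<i> s] by (auto simp: g_def)
    then show ?case by (simp add: E_def)
  qed
qed

text \<open>For a test vector living where \<psi> exceeds \<open>C^2\<close>, the bound on
  \<open>T'\<close> makes the integral of \<open>(\<psi> - C^2) * (cmod g)^2\<close> at most 0,
  although the integrand is positive on that set.\<close>

lemma multiplier_le: "AE s in N. \<psi> s \<le> C\<^sup>2"
proof -
  define E where "E = {s. \<psi> s > C\<^sup>2}"
  define g :: "real \<Rightarrow> complex" where "g s = indicator E s * cker \<i> s" for s
  have "E = {s \<in> space N. \<psi> s > C\<^sup>2}" using sets_eq_imp_space_eq[OF setsN] by (simp add: E_def)
  then have "E \<in> sets N" by simp
  then have E: "E \<in> sets borel" using setsN by simp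
  have g: "L2 N g" unfolding g_def by (rule L2_indicator_base[OF E])
  note eq = adj_norm_multiplication[OF T T' \<psi> mult g]
  have "(L2norm M (T' g))\<^sup>2 \<le> (C * L2norm N g)\<^sup>2"
    by (rule power_mono[OF L2_adj_bound[OF T T' g C]]) simp
  then have "(L2norm M (T' g))\<^sup>2 \<le> C\<^sup>2 * (\<integral>s. (cmod (g s))\<^sup>2 \<partial>N)"
    unfolding power_mult_distrib L2norm_power2[of N] .
  then have "(\<integral>s. \<psi> s * (cmod (g s))\<^sup>2 \<partial>N) \<le> C\<^sup>2 * (\<integral>s. (cmod (g s))\<^sup>2 \<partial>N)"
    using eq(1) by linarith
  moreover have int: "integrable N (\<lambda>s. \<psi> s * (cmod (g s))\<^sup>2 - C\<^sup>2 * (cmod (g s))\<^sup>2)"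
    by (intro Bochner_Integration.integrable_diff eq(2) integrable_mult_right L2_integrable[OF g])
  ultimately have "(\<integral>s. \<psi> s * (cmod (g s))\<^sup>2 - C\<^sup>2 * (cmod (g s))\<^sup>2 \<partial>N) \<le> 0"
    using eq(2) L2_integrable[OF g] by simp
  moreover have nonneg: "0 \<le> \<psi> s * (cmod (g s))\<^sup>2 - C\<^sup>2 * (cmod (g s))\<^sup>2" for s
    unfolding left_diff_distrib[symmetric]
    by (cases "s \<in> E") (auto simp: g_def E_def)
  ultimately have "(\<integral>s. \<psi> s * (cmod (g s))\<^sup>2 - C\<^sup>2 * (cmod (g s))\<^sup>2 \<partial>N) = 0"
    by (intro antisym Bochner_Integration.integral_nonneg) auto
  then have "AE s in N. \<psi> s * (cmod (g s))\<^sup>2 - C\<^sup>2 * (cmod (g s))\<^sup>2 = 0"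
    by (subst (asm) integral_nonneg_eq_0_iff_AE[OF int]) (rule AE_I2, rule nonneg)
  then show ?thesis
  proof eventually_elim
    case (elim s)
    then have "(\<psi> s - C\<^sup>2) * (cmod (g s))\<^sup>2 = 0" by (simp add: left_diff_distrib)
    then have "s \<notin> E" using cker_nonzero[of \<i> s] by (auto simp: g_def E_def)
    then show ?case by (simp add: E_def)
  qed
qed

text \<open>If \<open>g\<close> is \<open>T f / \<psi>\<close> on \<open>\<psi> > 1/n\<close> and \<open>0\<close> elsewhere, then
  \<open>\<parallel>T' g\<parallel>\<^sup>2 = \<langle>f, T' g\<rangle>\<close> is the integral of \<open>|T f|\<^sup>2 / \<psi>\<close> over \<open>\<psi> > 1/n\<close>, and
  Cauchy-Schwarz bounds it by \<open>\<parallel>f\<parallel>\<^sup>2\<close>.\<close>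
lemma normalised_op_contraction:
  assumes pos: "AE s in N. \<psi> s > 0" and f: "L2 M f"
  shows "L2 N (\<lambda>s. complex_of_real (1 / sqrt (\<psi> s)) * T f s)"
    and "L2norm N (\<lambda>s. complex_of_real (1 / sqrt (\<psi> s)) * T f s) \<le> L2norm M f"
proof -
  have Tf: "L2 N (T f)" by (rule L2_op_L2[OF T f])
  note [measurable] = L2_measurable[OF Tf]
  \<comment> \<open>The cut keeps \<open>m n\<close> at most \<open>n + 1\<close>, so
    \<open>g n\<close> stays in L2 although \<open>1 / \<psi>\<close> may be unbounded.\<close>
  define m where "m n s = (if \<psi> s > inverse (real (Suc n)) then 1 / \<psi> s else 0)" for n s
  have mm [measurable]: "m n \<in> borel_measurable N" for n unfolding m_def by measurable
  define g where "g n s = complex_of_real (m n s) * T f s" for n s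
  have g: "L2 N (g n)" for n
    unfolding g_def
  proof (rule L2_mult[where C = "real (Suc n)", OF Tf])
    have "\<bar>m n s\<bar> \<le> real (Suc n)" for s
    proof (cases "\<psi> s > inverse (real (Suc n))")
      case True
      then have "inverse (\<psi> s) \<le> inverse (inverse (real (Suc n)))"
        by (intro le_imp_inverse_le) auto
      moreover have "\<psi> s > 0" using True by (meson inverse_positive_iff_positive less_trans of_nat_0_less_iff zero_less_Suc)
      ultimately show ?thesis using True by (simp add: m_def inverse_eq_divide)
    qed (simp add: m_def)
    then show "AE s in N. cmod (complex_of_real (m n s)) \<le> real (Suc n)" by (simp del: of_nat_Suc)
  qed measurable
  have sq: "\<psi> s * (cmod (g n s))\<^sup>2 = m n s * (cmod (T f s))\<^sup>2" for n s
  proof -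
    have "\<psi> s * (m n s)\<^sup>2 = m n s"
      by (cases "\<psi> s = 0") (auto simp: m_def power2_eq_square)
    then show ?thesis by (simp add: g_def norm_mult power_mult_distrib flip: mult.assoc)
  qed
  define a where "a n = (\<integral>s. m n s * (cmod (T f s))\<^sup>2 \<partial>N)" for n
  have a_int: "integrable N (\<lambda>s. m n s * (cmod (T f s))\<^sup>2)" for n
    using adj_norm_multiplication(2)[OF T T' \<psi> mult g, of n] by (simp only: sq)
  have a_eq: "(L2norm M (T' (g n)))\<^sup>2 = a n" for n
    using adj_norm_multiplication(1)[OF T T' \<psi> mult g, of n] by (simp only: sq a_def)
  have a_le: "a n \<le> (L2norm M f)\<^sup>2" for n
  proof -
    have "ip M f (T' (g n)) = ip N (T f) (g n)" by (rule L2_adj_ip[OF T' g f, symmetric])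
    also have "\<dots> = (\<integral>s. complex_of_real (m n s * (cmod (T f s))\<^sup>2) \<partial>N)"
      unfolding ip_def g_def
      by (intro Bochner_Integration.integral_cong refl)
         (simp add: complex_norm_square mult_ac del: of_real_power)
    also have "\<dots> = complex_of_real (a n)" unfolding a_def by (rule integral_complex_of_real)
    finally have "\<bar>a n\<bar> \<le> L2norm M f * L2norm M (T' (g n))"
      using L2_Cauchy_Schwarz[OF f L2_adj_L2[OF T' g], of n] by simp
    then have "L2norm M (T' (g n)) * L2norm M (T' (g n)) \<le> L2norm M f * L2norm M (T' (g n))"
      using a_eq[of n] by (simp add: power2_eq_square)
    then have "L2norm M (T' (g n)) \<le> L2norm M f"
      by (cases "L2norm M (T' (g n)) = 0") (use L2norm_nonneg[of M "T' (g n)"] in \<open>auto simp: less_le\<close>)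
    then show ?thesis unfolding a_eq[symmetric] by (rule power_mono) simp
  qed
  define u where "u s = complex_of_real (1 / sqrt (\<psi> s)) * T f s" for s
  have um [measurable]: "u \<in> borel_measurable N" unfolding u_def by measurable
  \<comment> \<open>Wherever \<psi> is positive the truncated integrands are eventually constant in
    \<open>n\<close>; Fatou turns the uniform bound \<open>a_le\<close> into both membership in L2
    and the norm estimate.\<close>
  have "(\<integral>\<^sup>+s. ennreal ((cmod (u s))\<^sup>2) \<partial>N) = (\<integral>\<^sup>+s. liminf (\<lambda>n. ennreal (m n s * (cmod (T f s))\<^sup>2)) \<partial>N)"
  proof (rule nn_integral_cong_AE, use pos in eventually_elim)
    case (elim s)
    obtain K where K: "inverse (real (Suc K)) < \<psi> s" using reals_Archimedean[OF elim] by blast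
    have "\<forall>\<^sub>F n in sequentially. ennreal (m n s * (cmod (T f s))\<^sup>2) = ennreal ((cmod (u s))\<^sup>2)"
      using eventually_ge_at_top[of K]
    proof eventually_elim
      case (elim n)
      have "inverse (real (Suc n)) \<le> inverse (real (Suc K))" using elim by (intro le_imp_inverse_le) auto
      then have "inverse (real (Suc n)) < \<psi> s" using K by (rule le_less_trans)
      then have "m n s = 1 / \<psi> s" by (simp add: m_def del: of_nat_Suc)
      moreover have "(cmod (u s))\<^sup>2 = (1 / \<psi> s) * (cmod (T f s))\<^sup>2"
        using \<open>\<psi> s > 0\<close> by (simp add: u_def norm_mult norm_divide power_mult_distrib power_divide)
      ultimately show ?case by simp
    qed
    then have "(\<lambda>n. ennreal (m n s * (cmod (T f s))\<^sup>2)) \<longlonglongrightarrow> ennreal ((cmod (u s))\<^sup>2)"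
      by (rule tendsto_eventually)
    then show ?case by (intro lim_imp_Liminf[symmetric]) auto
  qed
  also have "\<dots> \<le> liminf (\<lambda>n. \<integral>\<^sup>+s. ennreal (m n s * (cmod (T f s))\<^sup>2) \<partial>N)"
    by (rule nn_integral_liminf) simp
  also have "\<dots> \<le> ennreal ((L2norm M f)\<^sup>2)"
  proof (rule Liminf_le)
    have "(\<integral>\<^sup>+s. ennreal (m n s * (cmod (T f s))\<^sup>2) \<partial>N) = ennreal (a n)" for n
      unfolding a_def
    proof (rule nn_integral_eq_integral[OF a_int])
      have "0 \<le> m n s" for s
        unfolding m_def by (auto intro: order_trans[of _ "inverse (real (Suc n))"])
      then show "AE s in N. 0 \<le> m n s * (cmod (T f s))\<^sup>2" by simp
    qed
    then show "\<forall>\<^sub>F n in sequentially. (\<integral>\<^sup>+s. ennreal (m n s * (cmod (T f s))\<^sup>2) \<partial>N) \<le> ennreal ((L2norm M f)\<^sup>2)"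
      using a_le by (simp add: ennreal_leI)
  qed simp
  finally have le: "(\<integral>\<^sup>+s. ennreal ((cmod (u s))\<^sup>2) \<partial>N) \<le> ennreal ((L2norm M f)\<^sup>2)" .
  then have int: "integrable N (\<lambda>s. (cmod (u s))\<^sup>2)"
    by (intro integrableI_bounded) (auto simp: less_top top_unique intro: le_less_trans)
  have "ennreal ((L2norm N u)\<^sup>2) \<le> ennreal ((L2norm M f)\<^sup>2)"
    using le nn_integral_eq_integral[OF int] by (simp add: L2norm_power2)
  then have "(L2norm N u)\<^sup>2 \<le> (L2norm M f)\<^sup>2" by simp
  then have "L2norm N u \<le> L2norm M f" by (rule power2_le_imp_le) simp
  with int show "L2 N (\<lambda>s. complex_of_real (1 / sqrt (\<psi> s)) * T f s)"
    "L2norm N (\<lambda>s. complex_of_real (1 / sqrt (\<psi> s)) * T f s) \<le> L2norm M f"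
    unfolding u_def[symmetric] L2_def by simp_all
qed

end

section \<open>Unitarity of the normalised operator and the intertwining relation\<close>

theorem theorem2p2:
  fixes \<mu> \<nu> :: "real measure" and \<alpha> :: real
    and T :: "(real \<Rightarrow> complex) \<Rightarrow> (real \<Rightarrow> complex)"
  assumes sets_mu: "sets \<mu> = sets borel"
    and sets_nu: "sets \<nu> = sets borel"
    and two_points: "\<exists>a b. a \<noteq> b \<and> a \<in> measure_support \<mu> \<and> b \<in> measure_support \<mu>"
    and int_mu: "integrable \<mu> (\<lambda>t. 1 / (1 + \<bar>t\<bar>))"
    and alpha_nz: "\<alpha> \<noteq> 0"
    \<comment> \<open>T is a bounded linear operator L2(mu) -> L2(nu) extending V\<close>
    and T_L2: "\<And>f. L2 \<mu> f \<Longrightarrow> L2 \<nu> (T f)"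
    and T_wd: "\<And>f g. L2 \<mu> f \<Longrightarrow> L2 \<mu> g \<Longrightarrow> (AE t in \<mu>. f t = g t) \<Longrightarrow> (AE s in \<nu>. T f s = T g s)"
    and T_add: "\<And>f g. L2 \<mu> f \<Longrightarrow> L2 \<mu> g \<Longrightarrow> (AE s in \<nu>. T (\<lambda>t. f t + g t) s = T f s + T g s)"
    and T_scal: "\<And>c f. L2 \<mu> f \<Longrightarrow> (AE s in \<nu>. T (\<lambda>t. c * f t) s = c * T f s)"
    and T_bdd: "\<exists>C. \<forall>f. L2 \<mu> f \<longrightarrow> L2norm \<nu> (T f) \<le> C * L2norm \<mu> f"
    and T_ext: "\<And>f. C1c f \<Longrightarrow> (AE s in \<nu>. T f s = Vop \<alpha> \<mu> f s)"
    \<comment> \<open>Ker V = {0}\<close>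
    and T_ker: "\<And>f. L2 \<mu> f \<Longrightarrow> (AE s in \<nu>. T f s = 0) \<Longrightarrow> (AE t in \<mu>. f t = 0)"
  shows "\<exists>h :: real \<Rightarrow> complex. h \<in> borel_measurable \<nu>
           \<and> (AE s in \<nu>. h s \<noteq> 0) \<and> (\<exists>K. AE s in \<nu>. cmod (1 / h s) \<le> K)
           \<and> (\<forall>f. L2 \<mu> f \<longrightarrow> L2 \<nu> (\<lambda>s. h s * T f s)
                    \<and> L2norm \<nu> (\<lambda>s. h s * T f s) = L2norm \<mu> f)
           \<and> (\<forall>g. L2 \<nu> g \<longrightarrow> (\<exists>f. L2 \<mu> f \<and> (AE s in \<nu>. h s * T f s = g s)))
           \<and> (\<forall>z. Im z \<noteq> 0 \<longrightarrow> (\<forall>f. L2 \<mu> f \<longrightarrow>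
                (AE s in \<nu>. h s * T (resolv_A \<alpha> \<mu> z f) s
                             = (h s * T f s) / (complex_of_real s - z))))"
proof -
  obtain a where "a \<in> measure_support \<mu>" using two_points by blast
  then have "emeasure \<mu> UNIV > 0" unfolding measure_support_def by auto
  then have nz: "emeasure \<mu> UNIV \<noteq> 0" by simp
  obtain C0 where C0: "\<And>f. L2 \<mu> f \<Longrightarrow> L2norm \<nu> (T f) \<le> C0 * L2norm \<mu> f" using T_bdd by blast
  \<comment> \<open>The given constant may have either sign; a nonnegative one allows norm bounds to
    be squared.\<close>
  define C where "C = \<bar>C0\<bar>"
  have C: "C \<ge> 0" by (simp add: C_def)
  have bdd: "L2norm \<nu> (T f) \<le> C * L2norm \<mu> f" if "L2 \<mu> f" for f
    using C0[OF that] mult_right_mono[OF abs_ge_self[of C0], of "L2norm \<mu> f"] by (simp add: C_def)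
  have T: "L2_op \<mu> \<nu> C T"
    unfolding L2_op_def using T_L2 T_add T_scal bdd by blast
  define P where "P z = 1 + complex_of_real \<alpha> * Fcauchy \<mu> z" for z
  have P: "P z \<noteq> 0" if "Im z \<noteq> 0" for z
    unfolding P_def by (rule one_plus_Fcauchy_nonzero[OF sets_mu int_mu nz alpha_nz that])
  have Tc: "AE s in \<nu>. T (cker z) s = P z * cker z s" if z: "Im z \<noteq> 0" for z
    unfolding P_def
    by (rule extension_cker[OF sets_mu int_mu T T_ext z])
  have bi: "Im \<i> \<noteq> 0" by simp
  have b: "L2 \<mu> (cker \<i>)" by (rule L2_cker_base[OF sets_mu int_mu bi])
  have ckm: "cker \<i> \<in> borel_measurable \<nu>"
    using sets_nu cker_measurable measurable_cong_sets by blast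
  \<comment> \<open>The kernel enters L2(\<nu>) as the image of \<open>cker \<i>\<close> divided by
    the non-zero number \<open>P \<i>\<close>; all integrability on the \<nu> side stems from
    here.\<close>
  have base: "L2 \<nu> (cker \<i>)"
  proof (rule L2_cong_AE[OF L2_scale[OF L2_op_L2[OF T b], of "1 / P \<i>"] ckm])
    show "AE s in \<nu>. 1 / P \<i> * T (cker \<i>) s = cker \<i> s"
      using Tc[OF bi] by eventually_elim (use P[OF bi] in simp)
  qed
  have inter: "AE s in \<nu>. T (resolv_A \<alpha> \<mu> z f) s = cker z s * T f s"
    if z: "Im z \<noteq> 0" and f: "L2 \<mu> f" for z f
    using resolvent_intertwining[OF sets_mu int_mu nz alpha_nz sets_nu T Tc[unfolded P_def] z f] .
  obtain T' where T': "L2_adj \<mu> \<nu> T T'"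
    using L2_adj_exists[OF b cker_nonzero[OF bi] T] by blast
  obtain \<psi> :: "real \<Rightarrow> real" where \<psi>: "\<psi> \<in> borel_measurable \<nu>"
    and mult: "\<And>g. L2 \<nu> g \<Longrightarrow> AE s in \<nu>. T (T' g) s = complex_of_real (\<psi> s) * g s"
    using op_adj_multiplication[OF sets_mu int_mu nz alpha_nz sets_nu base T T' inter] by blast
  note ctx = sets_mu int_mu sets_nu base T T' C \<psi> mult
  have pos: "AE s in \<nu>. \<psi> s > 0"
    using multiplier_pos[OF ctx Tc P] .
  have le: "AE s in \<nu>. \<psi> s \<le> C\<^sup>2"
    using multiplier_le[OF ctx] .
  \<comment> \<open>Where \<psi> fails to be positive, \<open>sqrt\<close> and division still return
    some value; that set is null.\<close>
  define h where "h s = complex_of_real (1 / sqrt (\<psi> s))" for s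
  have hm: "h \<in> borel_measurable \<nu>" unfolding h_def using \<psi> by measurable
  define U where "U f s = h s * T f s" for f s
  have U_L2: "L2 \<nu> (U f)" and U_bdd: "L2norm \<nu> (U f) \<le> L2norm \<mu> f" if "L2 \<mu> f" for f
    using normalised_op_contraction[OF ctx pos that] unfolding U_def h_def by auto
  have U: "L2_op \<mu> \<nu> 1 U"
    unfolding L2_op_def
  proof (intro conjI allI impI)
    fix f g c assume f: "L2 \<mu> f"
    show "L2 \<nu> (U f)" "L2norm \<nu> (U f) \<le> 1 * L2norm \<mu> f" using U_L2[OF f] U_bdd[OF f] by simp_all
    show "AE s in \<nu>. U (\<lambda>t. c * f t) s = c * U f s"
      using T_scal[OF f, of c] by eventually_elim (simp add: U_def)
    assume g: "L2 \<mu> g"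
    show "AE s in \<nu>. U (\<lambda>t. f t + g t) s = U f s + U g s"
      using T_add[OF f g] by eventually_elim (simp add: U_def distrib_left)
  qed
  have U_inter: "AE s in \<nu>. U (resolv_A \<alpha> \<mu> z f) s = cker z s * U f s"
    if "Im z \<noteq> 0" "L2 \<mu> f" for z f
    using inter[OF that] by eventually_elim (simp add: U_def)
  obtain U' where U': "L2_adj \<mu> \<nu> U U'"
    using L2_adj_exists[OF b cker_nonzero[OF bi] U] by blast
  obtain \<phi> :: "real \<Rightarrow> real" where \<phi>: "\<phi> \<in> borel_measurable \<nu>"
    and U_mult: "\<And>g. L2 \<nu> g \<Longrightarrow> AE s in \<nu>. U (U' g) s = complex_of_real (\<phi> s) * g s"
    using op_adj_multiplication[OF sets_mu int_mu nz alpha_nz sets_nu base U U' U_inter] by blast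
  \<comment> \<open>It suffices to find one nowhere vanishing \<open>g\<close> with \<open>U (U' g) = g\<close>; for \<open>g = sqrt \<psi> * cker \<i>\<close>, \<open>U' g = T' (cker \<i>)\<close>.\<close>
  have \<phi>1: "AE s in \<nu>. \<phi> s = 1"
  proof -
    define g where "g s = complex_of_real (sqrt (\<psi> s)) * cker \<i> s" for s
    have g: "L2 \<nu> g"
      unfolding g_def
    proof (rule L2_mult[where C = C, OF base])
      show "(\<lambda>s. complex_of_real (sqrt (\<psi> s))) \<in> borel_measurable \<nu>" using \<psi> by measurable
      show "AE s in \<nu>. cmod (complex_of_real (sqrt (\<psi> s))) \<le> C"
        using pos le by eventually_elim (use C in \<open>auto intro: real_le_lsqrt\<close>)
    qed
    define k where "k = (\<lambda>t. U' g t - T' (cker \<i>) t)"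
    have Ug: "L2 \<mu> (U' g)" by (rule L2_adj_L2[OF U' g])
    have Tb: "L2 \<mu> (T' (cker \<i>))" by (rule L2_adj_L2[OF T' base])
    have k: "L2 \<mu> k" unfolding k_def by (rule L2_diff[OF Ug Tb])
    \<comment> \<open>Because \<open>h * sqrt \<psi> = 1\<close>, the vectors \<open>U' g\<close>
      and \<open>T' (cker \<i>)\<close> have equal inner products with everything, in particular
      with their difference \<open>k\<close>.\<close>
    have "ip \<mu> k (U' g) = ip \<nu> (U k) g" by (rule L2_adj_ip[OF U' g k, symmetric])
    also have "\<dots> = ip \<nu> (T k) (cker \<i>)"
      unfolding ip_def
    proof (rule integral_cong_AE)
      show "(\<lambda>s. U k s * cnj (g s)) \<in> borel_measurable \<nu>"
        by (rule borel_measurable_integrable[OF ip_integrable[OF U_L2[OF k] g]])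
      show "(\<lambda>s. T k s * cnj (cker \<i> s)) \<in> borel_measurable \<nu>"
        by (rule borel_measurable_integrable[OF ip_integrable[OF L2_op_L2[OF T k] base]])
      show "AE s in \<nu>. U k s * cnj (g s) = T k s * cnj (cker \<i> s)"
        using pos by eventually_elim (simp add: U_def g_def h_def)
    qed
    also have "\<dots> = ip \<mu> k (T' (cker \<i>))" by (rule L2_adj_ip[OF T' base k])
    finally have "ip \<mu> k k = 0"
      using ip_diff_right[OF Ug Tb k] by (simp add: k_def)
    then have "L2norm \<mu> k = 0" by (simp add: ip_self)
    from L2norm_eq_0[OF k this] have "AE t in \<mu>. U' g t = T' (cker \<i>) t" by (simp add: k_def)
    from L2_op_cong[OF U Ug Tb this] U_mult[OF g] mult[OF base] pos
    show ?thesis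
    proof eventually_elim
      case (elim s)
      have "complex_of_real (\<phi> s) * g s = U (T' (cker \<i>)) s" using elim(1,2) by (simp only:)
      also have "\<dots> = h s * (complex_of_real (\<psi> s) * cker \<i> s)" using elim(3) by (simp add: U_def)
      also have "h s * complex_of_real (\<psi> s) = complex_of_real (sqrt (\<psi> s))"
        using elim(4) by (simp add: h_def real_div_sqrt flip: of_real_divide of_real_mult)
      then have "h s * (complex_of_real (\<psi> s) * cker \<i> s) = g s"
        by (simp add: g_def flip: mult.assoc)
      finally have "complex_of_real (\<phi> s) * g s = g s" .
      moreover have "g s \<noteq> 0" using elim(4) cker_nonzero[OF bi] by (simp add: g_def)
      ultimately show ?case by simp
    qed
  qed
  have UU': "AE s in \<nu>. U (U' g) s = g s" if "L2 \<nu> g" for g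
    using U_mult[OF that] \<phi>1 by eventually_elim simp
  have U'_norm: "L2norm \<mu> (U' g) = L2norm \<nu> g" if g: "L2 \<nu> g" for g
  proof -
    have "complex_of_real ((L2norm \<mu> (U' g))\<^sup>2) = ip \<nu> (U (U' g)) g" by (rule L2_adj_norm[OF U' g])
    also have "\<dots> = ip \<nu> g g"
      by (rule ip_cong_AE[OF L2_measurable[OF U_L2[OF L2_adj_L2[OF U' g]]] L2_measurable[OF g]
            L2_measurable[OF g] L2_measurable[OF g] UU'[OF g]]) simp
    finally have "(L2norm \<mu> (U' g))\<^sup>2 = (L2norm \<nu> g)\<^sup>2" by (simp only: ip_self of_real_eq_iff)
    then show ?thesis by (simp add: power2_eq_iff_nonneg)
  qed
  have U_norm: "L2norm \<nu> (U f) = L2norm \<mu> f" if f: "L2 \<mu> f" for f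
  proof -
    have f': "L2 \<mu> (U' (U f))" by (rule L2_adj_L2[OF U' U_L2[OF f]])
    \<comment> \<open>By \<open>U U' = 1\<close> the difference is annihilated by \<open>U\<close>,
      hence by \<open>T\<close> because \<open>h\<close> is non-zero. Triviality of the kernel gives
      \<open>U' U = 1\<close>, and the isometry of \<open>U'\<close> passes to
      \<open>U\<close>.\<close>
    have "AE s in \<nu>. T (\<lambda>t. U' (U f) t - f t) s = 0"
      using UU'[OF U_L2[OF f]] L2_op_diff[OF T f' f] pos
      by eventually_elim (auto simp: U_def h_def)
    from T_ker[OF L2_diff[OF f' f] this] have "AE t in \<mu>. U' (U f) t = f t" by simp
    then have "L2norm \<mu> (U' (U f)) = L2norm \<mu> f"
      by (rule L2norm_cong_AE[OF L2_measurable[OF f'] L2_measurable[OF f]])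
    then show ?thesis using U'_norm[OF U_L2[OF f]] by simp
  qed
  show ?thesis
  proof (rule exI[of _ h], intro conjI allI impI)
    show "h \<in> borel_measurable \<nu>" by (rule hm)
    show "AE s in \<nu>. h s \<noteq> 0" using pos by eventually_elim (simp add: h_def)
    have "AE s in \<nu>. cmod (1 / h s) \<le> C"
      using pos le by eventually_elim (use C in \<open>auto simp: h_def norm_divide intro: real_le_lsqrt\<close>)
    then show "\<exists>K. AE s in \<nu>. cmod (1 / h s) \<le> K" by blast
  next
    fix f assume f: "L2 \<mu> f"
    show "L2 \<nu> (\<lambda>s. h s * T f s)" "L2norm \<nu> (\<lambda>s. h s * T f s) = L2norm \<mu> f"
      using U_L2[OF f] U_norm[OF f] by (simp_all add: U_def[abs_def])
  next
    fix g assume g: "L2 \<nu> g"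
    show "\<exists>f. L2 \<mu> f \<and> (AE s in \<nu>. h s * T f s = g s)"
      using UU'[OF g] by (intro exI[of _ "U' g"] conjI L2_adj_L2[OF U' g]) (simp add: U_def)
  next
    fix z f assume "Im z \<noteq> 0" "L2 \<mu> f"
    from inter[OF this]
    show "AE s in \<nu>. h s * T (resolv_A \<alpha> \<mu> z f) s = (h s * T f s) / (complex_of_real s - z)"
      by eventually_elim (simp add: cker_def)
  qed
qed

end
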